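(* There is a constant $c$ such that for every $k>2$ there is a graph $H$ with at most $c\cdot k$ vertices which is identified by $C^3$, such that the $C^k$-partition classes of $H$ are exactly the orbits of $H$, but there are vertex-colored versions of $H$ that are not identified by $C^k$ and for which the $C^k$-partition classes are not the orbits.
   Context: Graphs are finite, undirected, without loops. $C^k$ is the $k$-variable fragment of first-order logic extended by counting quantifiers $\exists^{\ge t}$, variables reusable. A (vertex-colored) graph is identified by $C^k$ if some $C^k$-sentence (with unary predicates for vertex colors) holds in it and only in (vertex-colored) graphs isomorphic to it. The $C^k$-partition partitions the vertex set according to $C^k$-types of vertices; orbits are those of the (color-preserving) automorphism group. *)

theory Defs
  imports Main
begin

record 'v graph =
  verts :: "'v set"
  edges :: "'v set set"

definition is_graph :: "'v graph \<Rightarrow> bool" where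
  "is_graph G \<longleftrightarrow> finite (verts G) \<and> (\<forall>e\<in>edges G. e \<subseteq> verts G \<and> card e = 2)"

definition graph_iso :: "'v graph \<Rightarrow> 'w graph \<Rightarrow> ('v \<Rightarrow> 'w) \<Rightarrow> bool" where
  "graph_iso G G' f \<longleftrightarrow> bij_betw f (verts G) (verts G') \<and>
     (\<forall>u\<in>verts G. \<forall>v\<in>verts G. {u, v} \<in> edges G \<longleftrightarrow> {f u, f v} \<in> edges G')"

(* Colors are natural numbers. Only the values of a coloring
   on the vertex set matter. *)
definition cgraph_iso ::
  "'v graph \<Rightarrow> ('v \<Rightarrow> nat) \<Rightarrow> 'w graph \<Rightarrow> ('w \<Rightarrow> nat) \<Rightarrow> ('v \<Rightarrow> 'w) \<Rightarrow> bool" where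
  "cgraph_iso G \<chi> G' \<chi>' f \<longleftrightarrow> graph_iso G G' f \<and> (\<forall>v\<in>verts G. \<chi>' (f v) = \<chi> v)"

definition orbits :: "'v graph \<Rightarrow> 'v set set" where
  "orbits G = (\<lambda>v. {f v | f. graph_iso G G f}) ` verts G"

definition corbits :: "'v graph \<Rightarrow> ('v \<Rightarrow> nat) \<Rightarrow> 'v set set" where
  "corbits G \<chi> = (\<lambda>v. {f v | f. cgraph_iso G \<chi> G \<chi> f}) ` verts G"

(* First-order logic with counting quantifiers. Variables are natural numbers; Col c x says that
   x has color c, and ExGe t x p is "there are at least t vertices x such that p". *)
datatype form =
    Eq nat nat
  | Adj nat nat
  | Col nat nat
  | Neg form
  | Conj form form
  | ExGe nat nat form

primrec form_vars :: "form \<Rightarrow> nat set" where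
  "form_vars (Eq x y) = {x, y}"
| "form_vars (Adj x y) = {x, y}"
| "form_vars (Col c x) = {x}"
| "form_vars (Neg p) = form_vars p"
| "form_vars (Conj p q) = form_vars p \<union> form_vars q"
| "form_vars (ExGe t x p) = insert x (form_vars p)"

primrec free_vars :: "form \<Rightarrow> nat set" where
  "free_vars (Eq x y) = {x, y}"
| "free_vars (Adj x y) = {x, y}"
| "free_vars (Col c x) = {x}"
| "free_vars (Neg p) = free_vars p"
| "free_vars (Conj p q) = free_vars p \<union> free_vars q"
| "free_vars (ExGe t x p) = free_vars p - {x}"

primrec form_cols :: "form \<Rightarrow> nat set" where
  "form_cols (Eq x y) = {}"
| "form_cols (Adj x y) = {}"
| "form_cols (Col c x) = {c}"
| "form_cols (Neg p) = form_cols p"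
| "form_cols (Conj p q) = form_cols p \<union> form_cols q"
| "form_cols (ExGe t x p) = form_cols p"

primrec csat :: "'v graph \<Rightarrow> ('v \<Rightarrow> nat) \<Rightarrow> (nat \<Rightarrow> 'v) \<Rightarrow> form \<Rightarrow> bool" where
  "csat G \<chi> a (Eq x y) \<longleftrightarrow> a x = a y"
| "csat G \<chi> a (Adj x y) \<longleftrightarrow> {a x, a y} \<in> edges G"
| "csat G \<chi> a (Col c x) \<longleftrightarrow> \<chi> (a x) = c"
| "csat G \<chi> a (Neg p) \<longleftrightarrow> \<not> csat G \<chi> a p"
| "csat G \<chi> a (Conj p q) \<longleftrightarrow> csat G \<chi> a p \<and> csat G \<chi> a q"
| "csat G \<chi> a (ExGe t x p) \<longleftrightarrow> t \<le> card {v \<in> verts G. csat G \<chi> (a(x := v)) p}"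

(* Formulas of C^k over the vocabulary of vertex-colored graphs and of graphs, respectively;
   variables may be requantified. *)
definition cCk :: "nat \<Rightarrow> form set" where
  "cCk k = {p. form_vars p \<subseteq> {..<k}}"

definition Ck :: "nat \<Rightarrow> form set" where
  "Ck k = {p \<in> cCk k. form_cols p = {}}"

(* Semantics of color-free formulas in an uncolored graph; the coloring supplied is irrelevant
   for them. *)
definition sat :: "'v graph \<Rightarrow> (nat \<Rightarrow> 'v) \<Rightarrow> form \<Rightarrow> bool" where
  "sat G a p \<longleftrightarrow> csat G (\<lambda>_. 0) a p"

lemma csat_eq_sat_if_color_free: "form_cols p = {} \<Longrightarrow> csat G \<chi> a p \<longleftrightarrow> sat G a p"
  unfolding sat_def by (induction p arbitrary: a) auto

(* For a sentence p, the truth value does not depend on the assignment. Comparison graphs are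
   taken with vertices in nat, which covers all finite graphs up to isomorphism. *)
definition identified :: "nat \<Rightarrow> 'v graph \<Rightarrow> bool" where
  "identified k G \<longleftrightarrow> (\<exists>p\<in>Ck k. free_vars p = {} \<and> (\<forall>a. sat G a p) \<and>
     (\<forall>G' :: nat graph. is_graph G' \<and> (\<forall>a. sat G' a p) \<longrightarrow> (\<exists>f. graph_iso G G' f)))"

definition cidentified :: "nat \<Rightarrow> 'v graph \<Rightarrow> ('v \<Rightarrow> nat) \<Rightarrow> bool" where
  "cidentified k G \<chi> \<longleftrightarrow> (\<exists>p\<in>cCk k. free_vars p = {} \<and> (\<forall>a. csat G \<chi> a p) \<and>
     (\<forall>(G' :: nat graph) \<chi>'. is_graph G' \<and> (\<forall>a. csat G' \<chi>' a p) \<longrightarrow>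
        (\<exists>f. cgraph_iso G \<chi> G' \<chi>' f)))"

(* The C^k-type of a vertex: all C^k-formulas with at most variable 0 free that it satisfies. *)
definition vtype :: "nat \<Rightarrow> 'v graph \<Rightarrow> 'v \<Rightarrow> form set" where
  "vtype k G v = {p \<in> Ck k. free_vars p \<subseteq> {0} \<and> sat G (\<lambda>_. v) p}"

definition cvtype :: "nat \<Rightarrow> 'v graph \<Rightarrow> ('v \<Rightarrow> nat) \<Rightarrow> 'v \<Rightarrow> form set" where
  "cvtype k G \<chi> v = {p \<in> cCk k. free_vars p \<subseteq> {0} \<and> csat G \<chi> (\<lambda>_. v) p}"

definition Ck_partition :: "nat \<Rightarrow> 'v graph \<Rightarrow> 'v set set" where
  "Ck_partition k G = (\<lambda>v. {w \<in> verts G. vtype k G w = vtype k G v}) ` verts G"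

definition cCk_partition :: "nat \<Rightarrow> 'v graph \<Rightarrow> ('v \<Rightarrow> nat) \<Rightarrow> 'v set set" where
  "cCk_partition k G \<chi> = (\<lambda>v. {w \<in> verts G. cvtype k G \<chi> w = cvtype k G \<chi> v}) ` verts G"

end

theory Submission
  imports Defs Complex_Main "HOL-Library.FuncSet" "HOL-Library.Nat_Bijection"
begin

text \<open>The graph is a Cai--Fuerer--Immerman graph over a sparse random system of linear equations over the
  two-element field, in which the assignments of \<^emph>\<open>both\<close> parities are kept for every equation. Without
  colours, renaming the two values of any variable is then an automorphism, so the orbits are the blocks
  (one per variable and per equation); a definable rank structure makes the blocks recognisable and three
  variables suffice to describe how they are joined. A colouring can select a parity for each
  equation, that is, a right-hand side. There are more equations than variables, so some equation is
  implied by the others and some right-hand side is unsolvable, but since every small set of equations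
  expands, all right-hand sides look alike to \<open>C\<^sup>k\<close>: Duplicator maintains a partial assignment that
  satisfies every small sum of equations whose variables are all pebbled. Leaving the parity of one
  implied equation uncoloured, its vertices of different parity lie in different orbits, although they have
  the same \<open>C\<^sup>k\<close>-type.\<close>

section \<open>Counting logic\<close>

lemma csat_free_cong:
  "(\<And>x. x \<in> free_vars p \<Longrightarrow> a x = b x) \<Longrightarrow> csat G \<chi> a p \<longleftrightarrow> csat G \<chi> b p"
proof (induction p arbitrary: a b)
  case (ExGe t x p)
  have "csat G \<chi> (a(x := v)) p \<longleftrightarrow> csat G \<chi> (b(x := v)) p" for v
    by (rule ExGe.IH) (use ExGe.prems in auto)
  then show ?case by simp
next
  case (Conj p q)
  have "csat G \<chi> a p \<longleftrightarrow> csat G \<chi> b p" by (rule Conj.IH(1)) (use Conj.prems in auto)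
  moreover have "csat G \<chi> a q \<longleftrightarrow> csat G \<chi> b q" by (rule Conj.IH(2)) (use Conj.prems in auto)
  ultimately show ?case by simp
next
  case (Neg p)
  have "csat G \<chi> a p \<longleftrightarrow> csat G \<chi> b p" by (rule Neg.IH) (use Neg.prems in auto)
  then show ?case by simp
qed auto

section \<open>The bijective pebble game\<close>

text \<open>\<open>Z\<close> is the invariant of a strategy for Duplicator. The bijection
  \<open>h\<close> is fixed before the new vertex is seen, so it carries the witnesses of a
  quantifier on one side onto those on the other, and their numbers agree.\<close>

lemma csat_bijective_game:
  fixes G :: "'v graph" and G' :: "'w graph"
  assumes eq: "\<And>a a' x y. Z a a' \<Longrightarrow> x < k \<Longrightarrow> y < k \<Longrightarrow> a x = a y \<longleftrightarrow> a' x = a' y"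
    and adj: "\<And>a a' x y. Z a a' \<Longrightarrow> x < k \<Longrightarrow> y < k \<Longrightarrow>
                {a x, a y} \<in> edges G \<longleftrightarrow> {a' x, a' y} \<in> edges G'"
    and col: "\<And>a a' x. Z a a' \<Longrightarrow> x < k \<Longrightarrow> \<chi> (a x) = \<chi>' (a' x)"
    and move: "\<And>a a' x. Z a a' \<Longrightarrow> x < k \<Longrightarrow>
                \<exists>h. bij_betw h (verts G) (verts G') \<and> (\<forall>v\<in>verts G. Z (a(x := v)) (a'(x := h v)))"
  shows "form_vars p \<subseteq> {..<k} \<Longrightarrow> Z a a' \<Longrightarrow> csat G \<chi> a p \<longleftrightarrow> csat G' \<chi>' a' p"
proof (induction p arbitrary: a a')
  case (Eq x y)
  then show ?case using eq[of a a' x y] by auto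
next
  case (Adj x y)
  then show ?case using adj[of a a' x y] by auto
next
  case (Col c x)
  then show ?case using col[of a a' x] by auto
next
  case (ExGe t x p)
  obtain h where h: "bij_betw h (verts G) (verts G')"
    and Z: "\<And>v. v \<in> verts G \<Longrightarrow> Z (a(x := v)) (a'(x := h v))"
    using move[of a a' x] ExGe.prems by auto
  have iff: "csat G \<chi> (a(x := v)) p \<longleftrightarrow> csat G' \<chi>' (a'(x := h v)) p" if "v \<in> verts G" for v
    by (rule ExGe.IH[OF _ Z[OF that]]) (use ExGe.prems in auto)
  have "{w \<in> verts G'. csat G' \<chi>' (a'(x := w)) p} = h ` {v \<in> verts G. csat G \<chi> (a(x := v)) p}"
    by (auto simp: bij_betw_imp_surj_on[OF h, symmetric] iff)
  moreover have "inj_on h {v \<in> verts G. csat G \<chi> (a(x := v)) p}"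
    using bij_betw_imp_inj_on[OF h] by (rule inj_on_subset) auto
  ultimately show ?case by (simp add: card_image)
qed auto

lemma vtype_graph_iso:
  assumes f: "graph_iso G G f" and v: "v \<in> verts G"
  shows "vtype k G (f v) = vtype k G v"
proof -
  let ?Z = "\<lambda>a a'. \<forall>x<k. a x \<in> verts G \<and> a' x = f (a x)"
  have bij: "bij_betw f (verts G) (verts G)"
    and adj: "\<And>u v. u \<in> verts G \<Longrightarrow> v \<in> verts G \<Longrightarrow> {u, v} \<in> edges G \<longleftrightarrow> {f u, f v} \<in> edges G"
    using f by (auto simp: graph_iso_def)
  have "csat G (\<lambda>_. 0) (\<lambda>_. v) p \<longleftrightarrow> csat G (\<lambda>_. 0) (\<lambda>_. f v) p" if "form_vars p \<subseteq> {..<k}" for p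
  proof (rule csat_bijective_game[where Z = ?Z and k = k])
    fix a a' x y
    assume Z: "?Z a a'" and "x < k" "y < k"
    then show "a x = a y \<longleftrightarrow> a' x = a' y" "{a x, a y} \<in> edges G \<longleftrightarrow> {a' x, a' y} \<in> edges G"
      using bij_betw_imp_inj_on[OF bij] adj by (auto dest: inj_onD)
  next
    fix a a' x
    assume "?Z a a'" "x < k"
    then show "\<exists>h. bij_betw h (verts G) (verts G) \<and> (\<forall>v\<in>verts G. ?Z (a(x := v)) (a'(x := h v)))"
      using bij by (intro exI[of _ f]) auto
  qed (use that v in auto)
  then show ?thesis by (auto simp: vtype_def Ck_def cCk_def sat_def)
qed

section \<open>Definability with three variables\<close>

text \<open>Formulas are not written out: a property is shown definable through closure rules on its
  meaning. \<open>A\<close> bounds the free variables, so \<open>A = {}\<close> yields sentences.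
  Meanings are compared on finite graphs only, because \<open>card\<close> is 0 on infinite
  sets.\<close>

definition expr3 :: "nat set \<Rightarrow> (nat graph \<Rightarrow> (nat \<Rightarrow> nat) \<Rightarrow> bool) \<Rightarrow> bool" where
  "expr3 A \<Phi> \<longleftrightarrow> (\<exists>p\<in>Ck 3. free_vars p \<subseteq> A \<and> (\<forall>G a. is_graph G \<longrightarrow> sat G a p = \<Phi> G a))"

lemma expr3_eq: "x < 3 \<Longrightarrow> y < 3 \<Longrightarrow> x \<in> A \<Longrightarrow> y \<in> A \<Longrightarrow> expr3 A (\<lambda>G a. a x = a y)"
  unfolding expr3_def by (rule bexI[of _ "Eq x y"]) (auto simp: sat_def Ck_def cCk_def)

lemma expr3_adj: "x < 3 \<Longrightarrow> y < 3 \<Longrightarrow> x \<in> A \<Longrightarrow> y \<in> A \<Longrightarrow> expr3 A (\<lambda>G a. {a x, a y} \<in> edges G)"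
  unfolding expr3_def by (rule bexI[of _ "Adj x y"]) (auto simp: sat_def Ck_def cCk_def)

lemma expr3_not: "expr3 A \<Phi> \<Longrightarrow> expr3 A (\<lambda>G a. \<not> \<Phi> G a)"
  unfolding expr3_def
proof (elim bexE conjE)
  fix p assume "p \<in> Ck 3" "free_vars p \<subseteq> A" "\<forall>G a. is_graph G \<longrightarrow> sat G a p = \<Phi> G a"
  then show "\<exists>p\<in>Ck 3. free_vars p \<subseteq> A \<and> (\<forall>G a. is_graph G \<longrightarrow> sat G a p = (\<not> \<Phi> G a))"
    by (intro bexI[of _ "Neg p"]) (auto simp: sat_def Ck_def cCk_def)
qed

lemma expr3_conj: "expr3 A \<Phi> \<Longrightarrow> expr3 A \<Psi> \<Longrightarrow> expr3 A (\<lambda>G a. \<Phi> G a \<and> \<Psi> G a)"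
  unfolding expr3_def
proof (elim bexE conjE)
  fix p q assume "p \<in> Ck 3" "free_vars p \<subseteq> A" "\<forall>G a. is_graph G \<longrightarrow> sat G a p = \<Phi> G a"
    "q \<in> Ck 3" "free_vars q \<subseteq> A" "\<forall>G a. is_graph G \<longrightarrow> sat G a q = \<Psi> G a"
  then show "\<exists>p\<in>Ck 3. free_vars p \<subseteq> A \<and> (\<forall>G a. is_graph G \<longrightarrow> sat G a p = (\<Phi> G a \<and> \<Psi> G a))"
    by (intro bexI[of _ "Conj p q"]) (auto simp: sat_def Ck_def cCk_def)
qed

lemma expr3_card_ge:
  assumes "x < 3" "expr3 (insert x A) \<Phi>"
  shows "expr3 A (\<lambda>G a. t \<le> card {v \<in> verts G. \<Phi> G (a(x := v))})"
proof -
  obtain p where "p \<in> Ck 3" "free_vars p \<subseteq> insert x A" "\<forall>G a. is_graph G \<longrightarrow> sat G a p = \<Phi> G a"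
    using assms(2) unfolding expr3_def by blast
  then show ?thesis using assms(1) unfolding expr3_def
    by (intro bexI[of _ "ExGe t x p"]) (auto simp: sat_def Ck_def cCk_def)
qed

lemma expr3_cong:
  "expr3 A \<Phi> \<Longrightarrow> (\<And>G a. is_graph G \<Longrightarrow> \<Phi> G a = \<Psi> G a) \<Longrightarrow> expr3 A \<Psi>"
  unfolding expr3_def by (elim bexE, rule bexI) simp_all

lemma expr3_const: assumes "0 \<in> A" shows "expr3 A (\<lambda>G a. c)"
proof -
  have "expr3 A (\<lambda>G a. a 0 = a 0)" using assms by (intro expr3_eq) auto
  from this expr3_not[OF this] show ?thesis by (cases c) simp_all
qed

lemma expr3_imp: "expr3 A \<Phi> \<Longrightarrow> expr3 A \<Psi> \<Longrightarrow> expr3 A (\<lambda>G a. \<Phi> G a \<longrightarrow> \<Psi> G a)"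
  by (rule expr3_cong[OF expr3_not[OF expr3_conj[OF _ expr3_not]]]) auto

lemma expr3_iff:
  assumes "expr3 A \<Phi>" "expr3 A \<Psi>"
  shows "expr3 A (\<lambda>G a. \<Phi> G a \<longleftrightarrow> \<Psi> G a)"
  by (rule expr3_cong[OF expr3_conj[OF expr3_imp[OF assms] expr3_imp[OF assms(2,1)]]]) auto

lemma expr3_ex:
  assumes "x < 3" "expr3 (insert x A) \<Phi>"
  shows "expr3 A (\<lambda>G a. \<exists>v\<in>verts G. \<Phi> G (a(x := v)))"
  by (rule expr3_cong[OF expr3_card_ge[OF assms, of 1]])
    (auto simp: is_graph_def Suc_le_eq card_gt_0_iff)

lemma expr3_all:
  assumes "x < 3" "expr3 (insert x A) \<Phi>"
  shows "expr3 A (\<lambda>G a. \<forall>v\<in>verts G. \<Phi> G (a(x := v)))"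
  by (rule expr3_cong[OF expr3_not[OF expr3_ex[OF assms(1) expr3_not[OF assms(2)]]]]) auto

lemma expr3_card_eq:
  assumes "x < 3" "expr3 (insert x A) \<Phi>"
  shows "expr3 A (\<lambda>G a. card {v \<in> verts G. \<Phi> G (a(x := v))} = t)"
  by (rule expr3_cong[OF expr3_conj[OF expr3_card_ge[OF assms, of t]
        expr3_not[OF expr3_card_ge[OF assms, of "Suc t"]]]]) auto

text \<open>Counting at least 0 witnesses gives a tautology without free variables, which covers the
  case that \<open>A\<close> is empty.\<close>

lemma expr3_true: "expr3 A (\<lambda>G a. True)"
  by (rule expr3_cong[OF expr3_card_ge[of 0 _ "\<lambda>G a. True" 0, OF _ expr3_const]]) auto

lemma expr3_ball:
  assumes "finite I" "\<And>i. i \<in> I \<Longrightarrow> expr3 A (\<Phi> i)"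
  shows "expr3 A (\<lambda>G a. \<forall>i\<in>I. \<Phi> i G a)"
  using assms
proof (induction rule: finite_induct)
  case empty
  then show ?case using expr3_true by simp
next
  case (insert i I)
  then have "expr3 A (\<lambda>G a. \<Phi> i G a \<and> (\<forall>i\<in>I. \<Phi> i G a))" by (intro expr3_conj) auto
  then show ?case by simp
qed

lemma expr3_bex:
  assumes "finite I" "\<And>i. i \<in> I \<Longrightarrow> expr3 A (\<Phi> i)"
  shows "expr3 A (\<lambda>G a. \<exists>i\<in>I. \<Phi> i G a)"
  by (rule expr3_cong[OF expr3_not[OF expr3_ball[OF assms(1) expr3_not[OF assms(2)]]]]) auto

text \<open>Asking for a formula at each of the three variables replaces substitution: a defined
  predicate can be placed at any variable, and the others may be requantified inside it.\<close>

definition unary3 :: "(nat graph \<Rightarrow> nat \<Rightarrow> bool) \<Rightarrow> bool" where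
  "unary3 D \<longleftrightarrow> (\<forall>x<3. \<forall>A. x \<in> A \<longrightarrow> expr3 A (\<lambda>G a. D G (a x)))"

lemma expr3_unary: "unary3 D \<Longrightarrow> x < 3 \<Longrightarrow> x \<in> A \<Longrightarrow> expr3 A (\<lambda>G a. D G (a x))"
  by (simp add: unary3_def)

lemma unary3_not: "unary3 D \<Longrightarrow> unary3 (\<lambda>G v. \<not> D G v)"
  by (auto simp: unary3_def intro!: expr3_not)

lemma unary3_conj: "unary3 D \<Longrightarrow> unary3 E \<Longrightarrow> unary3 (\<lambda>G v. D G v \<and> E G v)"
  by (auto simp: unary3_def intro!: expr3_conj)

lemma unary3_true: "unary3 (\<lambda>G v. True)"
  by (auto simp: unary3_def intro!: expr3_true)

definition nbs :: "nat graph \<Rightarrow> (nat graph \<Rightarrow> nat \<Rightarrow> bool) \<Rightarrow> nat \<Rightarrow> nat" where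
  "nbs G D v = card {w \<in> verts G. {v, w} \<in> edges G \<and> D G w}"

lemma unary3_nbs:
  assumes "unary3 D"
  shows "unary3 (\<lambda>G v. nbs G D v = t)" "unary3 (\<lambda>G v. t \<le> nbs G D v)"
proof -
  have "expr3 A (\<lambda>G a. nbs G D (a x) = t) \<and> expr3 A (\<lambda>G a. t \<le> nbs G D (a x))"
    if "x < 3" "x \<in> A" for x A
  proof -
    \<comment> \<open>One bound variable suffices; the formula for \<open>D\<close> at
      \<open>y\<close> may requantify \<open>x\<close>.\<close>
    define y where "y = (if x = 0 then 1 else 0 :: nat)"
    have y: "y < 3" "y \<noteq> x" by (auto simp: y_def)
    have e: "expr3 (insert y A) (\<lambda>G a. {a x, a y} \<in> edges G \<and> D G (a y))"
      using that y assms by (intro expr3_conj expr3_adj expr3_unary) auto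
    show ?thesis using expr3_card_eq[OF y(1) e] expr3_card_ge[OF y(1) e] y(2)
      by (simp add: nbs_def)
  qed
  then show "unary3 (\<lambda>G v. nbs G D v = t)" "unary3 (\<lambda>G v. t \<le> nbs G D v)"
    by (auto simp: unary3_def)
qed

section \<open>Sparse expanding systems of equations\<close>

lemma odd_card_sym_diff:
  assumes "finite A" "finite B"
  shows "odd (card (sym_diff A B)) \<longleftrightarrow> odd (card A) \<noteq> odd (card B)"
proof -
  have "card (sym_diff A B) = card (A - B) + card (B - A)"
    using assms by (intro card_Un_disjoint) auto
  moreover have "card A = card (A \<inter> B) + card (A - B)" "card B = card (A \<inter> B) + card (B - A)"
    using card_Int_Diff[OF assms(1), of B] card_Int_Diff[OF assms(2), of A] by (auto simp: Int_commute)
  ultimately show ?thesis by auto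
qed

text \<open>The variables that survive when the left-hand sides of the equations in \<open>S\<close>
  are added over the two-element field.\<close>

definition osupp :: "('j \<Rightarrow> 'x set) \<Rightarrow> 'j set \<Rightarrow> 'x set" where
  "osupp N S = {x. odd (card {j \<in> S. x \<in> N j})}"

lemma osupp_sym_diff:
  assumes "finite S" "finite T"
  shows "osupp N (sym_diff S T) = sym_diff (osupp N S) (osupp N T)"
proof -
  have "{j \<in> sym_diff S T. x \<in> N j} = sym_diff {j \<in> S. x \<in> N j} {j \<in> T. x \<in> N j}" for x
    by auto
  then have "odd (card {j \<in> sym_diff S T. x \<in> N j}) \<longleftrightarrow>
      odd (card {j \<in> S. x \<in> N j}) \<noteq> odd (card {j \<in> T. x \<in> N j})" for x
    using assms by (simp add: odd_card_sym_diff)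
  then show ?thesis unfolding osupp_def by blast
qed

lemma osupp_singleton [simp]: "osupp N {j} = N j"
proof -
  have "{i \<in> {j}. x \<in> N i} = (if x \<in> N j then {j} else {})" for x by auto
  then show ?thesis by (auto simp: osupp_def)
qed

lemma osupp_empty [simp]: "osupp N {} = {}"
  by (simp add: osupp_def)

lemma osupp_subset: "osupp N S \<subseteq> (\<Union>j\<in>S. N j)"
proof
  fix x assume "x \<in> osupp N S"
  then have "odd (card {j \<in> S. x \<in> N j})" by (simp add: osupp_def)
  then have "{j \<in> S. x \<in> N j} \<noteq> {}" by (metis card.empty even_zero)
  then show "x \<in> (\<Union>j\<in>S. N j)" by blast
qed

text \<open>Evaluation at the assignment \<open>f\<close> is linear: the value of a sum of equations
  is the sum of their values.\<close>

lemma odd_card_Int_osupp: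
  assumes "finite S" "\<And>j. j \<in> S \<Longrightarrow> finite (N j)"
  shows "odd (card (f \<inter> osupp N S)) \<longleftrightarrow> odd (card {j \<in> S. odd (card (f \<inter> N j))})"
  using assms
proof (induction rule: finite_induct)
  case (insert j S)
  have fin: "finite (osupp N S)"
    by (rule finite_subset[OF osupp_subset]) (use insert in auto)
  have "sym_diff S {j} = insert j S" using insert by auto
  then have "osupp N (insert j S) = sym_diff (osupp N S) (N j)"
    using osupp_sym_diff[of S "{j}" N] insert by simp
  then have "f \<inter> osupp N (insert j S) = sym_diff (f \<inter> osupp N S) (f \<inter> N j)" by auto
  then have 1: "odd (card (f \<inter> osupp N (insert j S))) \<longleftrightarrow>
      odd (card (f \<inter> osupp N S)) \<noteq> odd (card (f \<inter> N j))"
    using odd_card_sym_diff[of "f \<inter> osupp N S" "f \<inter> N j"] fin insert.prems by simp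
  have IH: "odd (card (f \<inter> osupp N S)) \<longleftrightarrow> odd (card {j \<in> S. odd (card (f \<inter> N j))})"
    using insert.IH insert.prems by simp
  have "{i \<in> insert j S. odd (card (f \<inter> N i))} =
     (if odd (card (f \<inter> N j)) then insert j {i \<in> S. odd (card (f \<inter> N i))}
      else {i \<in> S. odd (card (f \<inter> N i))})" by auto
  then show ?case using 1 IH insert.hyps by auto
qed simp

text \<open>There are more subsets of \<open>S\<close> than possible supports, so two subsets share
  one; their symmetric difference is a linear dependency.\<close>

lemma ex_osupp_empty:
  assumes "finite S" "finite X" "card X < card S" "\<And>j. j \<in> S \<Longrightarrow> N j \<subseteq> X"
  obtains T where "T \<subseteq> S" "T \<noteq> {}" "osupp N T = {}"
proof -
  have "osupp N T \<subseteq> X" if "T \<subseteq> S" for T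
    using osupp_subset[of N T] that assms(4) by blast
  then have "card (osupp N ` Pow S) \<le> card (Pow X)"
    using assms(2) by (intro card_mono) auto
  also have "\<dots> < card (Pow S)" using assms by (simp add: card_Pow)
  finally have "\<not> inj_on (osupp N) (Pow S)" by (rule pigeonhole)
  then obtain A B where AB: "A \<subseteq> S" "B \<subseteq> S" "A \<noteq> B" "osupp N A = osupp N B"
    by (auto simp: inj_on_def)
  then have "osupp N (sym_diff A B) = {}"
    using assms(1) by (subst osupp_sym_diff) (auto intro: finite_subset)
  then show thesis using AB that[of "sym_diff A B"] by auto
qed

text \<open>An element covered an even number of times is covered at least twice, so a large union
  forces a large odd support.\<close>
lemma card_osupp_ge:
  assumes "finite S" "\<And>j. j \<in> S \<Longrightarrow> finite (N j)" "\<And>j. j \<in> S \<Longrightarrow> card (N j) \<le> 5"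
    and union: "3 * card S \<le> card (\<Union>j\<in>S. N j)"
  shows "card S \<le> card (osupp N S)"
proof -
  let ?W = "\<Union>j\<in>S. N j"
  have finW: "finite ?W" using assms by auto
  have sub: "osupp N S \<subseteq> ?W" by (rule osupp_subset)
  \<comment> \<open>Double counting of incidences:
    \<open>6 * card S <= 2 * card ?W <= 5 * card S + card (osupp N S)\<close>.\<close>
  have "2 * card ?W = (\<Sum>x\<in>?W. 2)" by simp
  also have "\<dots> \<le> (\<Sum>x\<in>?W. card {j \<in> S. x \<in> N j} + (if x \<in> osupp N S then 1 else 0))"
  proof (rule sum_mono)
    fix x assume "x \<in> ?W"
    then have "card {j \<in> S. x \<in> N j} \<noteq> 0" using assms(1) by auto
    then have "card {j \<in> S. x \<in> N j} \<noteq> 1 \<Longrightarrow> 2 \<le> card {j \<in> S. x \<in> N j}" by linarith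
    then show "2 \<le> card {j \<in> S. x \<in> N j} + (if x \<in> osupp N S then 1 else 0)"
      using \<open>card {j \<in> S. x \<in> N j} \<noteq> 0\<close> by (cases "card {j \<in> S. x \<in> N j} = 1") (auto simp: osupp_def)
  qed
  also have "\<dots> = (\<Sum>x\<in>?W. card {j \<in> S. x \<in> N j}) + card (osupp N S)"
    using finW sub by (simp add: sum.distrib sum.If_cases Int_absorb1)
  also have "(\<Sum>x\<in>?W. card {j \<in> S. x \<in> N j}) = (\<Sum>x\<in>?W. \<Sum>j\<in>S. if x \<in> N j then 1 else 0)"
    using assms(1) by (simp add: sum.If_cases Int_def)
  also have "\<dots> = (\<Sum>j\<in>S. \<Sum>x\<in>?W. if x \<in> N j then 1 else 0)" by (rule sum.swap)
  also have "\<dots> = (\<Sum>j\<in>S. card (N j))"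
  proof (rule sum.cong[OF refl])
    fix j assume "j \<in> S"
    then have "?W \<inter> N j = N j" by auto
    then show "(\<Sum>x\<in>?W. if x \<in> N j then 1 else 0) = card (N j)"
      using finW by (simp add: sum.If_cases Int_def) 
  qed
  also have "\<dots> \<le> (\<Sum>j\<in>S. 5)" by (intro sum_mono assms)
  finally show ?thesis using union by simp
qed

section \<open>Existence of expanders by counting\<close>

text \<open>A weak Stirling bound; the induction step rests on
  \<open>(1 + 1/s) ^ s <= exp 1 <= 3\<close>.\<close>

lemma power_self_le_fact: "s ^ s \<le> 3 ^ s * (fact s :: nat)"
proof (induction s)
  case (Suc s)
  have "(Suc s :: nat) ^ s \<le> 3 * s ^ s"
  proof (cases "s = 0")
    case False
    have "(1 + 1 / real s) ^ s \<le> exp 1"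
      using exp_ge_one_plus_x_over_n_power_n[of s 1] False by simp
    also have "\<dots> \<le> 3" by (rule exp_le)
    finally have "(1 + 1 / real s) ^ s * real s ^ s \<le> 3 * real s ^ s"
      by (intro mult_right_mono) auto
    also have "(1 + 1 / real s) ^ s * real s ^ s = real (Suc s) ^ s"
      using False by (simp add: power_mult_distrib[symmetric] field_simps)
    finally have "real (Suc s ^ s) \<le> real (3 * s ^ s)" by simp
    then show ?thesis by (simp only: of_nat_le_iff)
  qed simp
  then have "Suc s ^ Suc s \<le> Suc s * (3 * s ^ s)" by (simp only: power_Suc mult_le_mono2)
  also have "\<dots> \<le> Suc s * (3 * (3 ^ s * fact s))" using Suc by (intro mult_left_mono) auto
  finally show ?case by (simp add: algebra_simps)
qed simp

text \<open>One summand of a union bound: the fraction of choices that send all picks of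
  \<open>s\<close> sets into a target of size \<open>3 * s\<close>, summed over all such pairs, is
  at most \<open>(1/3) ^ s\<close>.\<close>

lemma expander_term_bound:
  assumes "2187 * m * s \<le> n\<^sup>2"
  shows "3 ^ s * ((m choose s) * (n choose (3 * s)) * (3 * s) ^ (5 * s)) \<le> (n::nat) ^ (5 * s)"
proof -
  let ?P = "fact s * fact (3 * s) :: nat"
  have a: "(3 * s) ^ (3 * s) \<le> 27 ^ s * (fact (3 * s) :: nat)"
    using power_self_le_fact[of "3 * s"] by (simp add: power_mult)
  have e: "(3 * s) ^ (5 * s) = (3 * s) ^ (3 * s) * (9 ^ s * (s ^ s * s ^ s))"
  proof -
    have "(3 * s) ^ (5 * s) = (3 * s) ^ (3 * s) * (3 * s) ^ (2 * s)"
      by (simp only: power_add[symmetric]) simp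
    also have "(3 * s) ^ (2 * s) = 9 ^ s * (s ^ s * s ^ s)"
      by (simp add: power_mult power_mult_distrib power2_eq_square)
    finally show ?thesis .
  qed
  have b: "(3 * s) ^ (5 * s) \<le> (27 ^ s * fact (3 * s)) * (9 ^ s * (s ^ s * (3 ^ s * fact s)))"
    unfolding e using a power_self_le_fact[of s] by (intro mult_mono) auto
  \<comment> \<open>Multiplying by both factorials turns the binomials into powers; the constants
    collected are \<open>3 * 27 * 9 * 3 = 2187\<close>.\<close>
  have "(3 ^ s * ((m choose s) * (n choose (3 * s)) * (3 * s) ^ (5 * s))) * ?P
      = 3 ^ s * ((m choose s) * fact s) * ((n choose (3 * s)) * fact (3 * s)) * (3 * s) ^ (5 * s)"
    by (simp add: ac_simps)
  also have "\<dots> \<le> 3 ^ s * m ^ s * n ^ (3 * s) *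
      ((27 ^ s * fact (3 * s)) * (9 ^ s * (s ^ s * (3 ^ s * fact s))))"
    by (intro mult_mono binomial_fact_pow order_refl b) auto
  also have "\<dots> = (3 * 27 * 9 * 3 * m * s) ^ s * n ^ (3 * s) * ?P"
    by (simp only: power_mult_distrib) (simp add: ac_simps)
  also have "\<dots> \<le> (n\<^sup>2) ^ s * n ^ (3 * s) * ?P"
    using assms by (intro mult_mono power_mono) auto
  also have "\<dots> = n ^ (5 * s) * ?P"
    by (simp add: power_mult[symmetric] power_add[symmetric])
  finally show ?thesis by simp
qed

text \<open>A random choice works. Each set gets five picks from \<open>{..<n}\<close> with
  repetitions allowed. Expansion fails only if all picks for some \<open>S\<close> land in one set
  \<open>U\<close> of size \<open>3 * card S\<close>, and by a union bound less than half of all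
  choices are bad. The factor 4374 is \<open>2 * 2187\<close>, since
  \<open>m <= 2 * n\<close>.\<close>

lemma ex_expander:
  fixes n m r :: nat
  assumes "m \<le> 2 * n" "4374 * r \<le> n" "0 < r"
  obtains N :: "nat \<Rightarrow> nat set"
  where "\<And>j. j < m \<Longrightarrow> N j \<subseteq> {..<n}" "\<And>j. j < m \<Longrightarrow> N j \<noteq> {}" "\<And>j. j < m \<Longrightarrow> card (N j) \<le> 5"
    "\<And>S. S \<subseteq> {..<m} \<Longrightarrow> card S \<le> r \<Longrightarrow> 3 * card S \<le> card (\<Union>j\<in>S. N j)"
proof -
  let ?I = "{..<m} \<times> {..<5::nat}"
  define Om where "Om = (?I \<rightarrow>\<^sub>E {..<n})"
  define Bad where "Bad S U = (PiE ?I (\<lambda>(j, t). if j \<in> S then U else {..<n}))" for S U :: "nat set"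
  define Q where "Q s = {S. S \<subseteq> {..<m} \<and> card S = s} \<times> {U. U \<subseteq> {..<n} \<and> card U = 3 * s}" for s
  have n0: "n > 0" using assms by simp
  have cardOm: "card Om = n ^ (5 * m)" by (simp add: Om_def card_PiE mult.commute)
  have finQ: "finite (Q s)" for s unfolding Q_def by (intro finite_cartesian_product) auto
  have cardQ: "card (Q s) = (m choose s) * (n choose (3 * s))" for s
    unfolding Q_def by (simp add: card_cartesian_product n_subsets)
  have cardBad: "card (Bad S U) = (3 * s) ^ (5 * s) * n ^ (5 * (m - s))" if "(S, U) \<in> Q s" for S U s
  proof -
    have S: "S \<subseteq> {..<m}" "card S = s" and U: "card U = 3 * s" using that by (auto simp: Q_def)
    have "card (Bad S U) = (\<Prod>(j, t)\<in>?I. if j \<in> S then 3 * s else n)"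
      unfolding Bad_def by (subst card_PiE) (auto intro!: prod.cong simp: U)
    also have "\<dots> = (\<Prod>j<m. (if j \<in> S then 3 * s else n) ^ 5)"
      by (subst prod.cartesian_product[symmetric]) simp
    also have "\<dots> = (\<Prod>j<m. if j \<in> S then (3 * s) ^ 5 else n ^ 5)"
      by (intro prod.cong) auto
    also have "\<dots> = ((3 * s) ^ 5) ^ card ({..<m} \<inter> S) * (n ^ 5) ^ card ({..<m} \<inter> - S)"
      by (simp add: prod.If_cases)
    also have "{..<m} \<inter> S = S" using S by auto
    also have "card ({..<m} \<inter> - S) = m - s"
      using S card_Diff_subset[of S "{..<m}"] finite_subset[of S "{..<m}"] by (simp add: Diff_eq)
    finally show ?thesis using S by (simp add: power_mult)
  qed
  have "real (card (\<Union>s\<in>{1..r}. \<Union>(S, U)\<in>Q s. Bad S U)) \<le> (\<Sum>s\<in>{1..r}. real (n ^ (5 * m)) * (1/3) ^ s)"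
  proof -
    have "card (\<Union>s\<in>{1..r}. \<Union>(S, U)\<in>Q s. Bad S U) \<le> (\<Sum>s\<in>{1..r}. card (\<Union>(S, U)\<in>Q s. Bad S U))"
      by (rule card_UN_le) simp
    then have "real (card (\<Union>s\<in>{1..r}. \<Union>(S, U)\<in>Q s. Bad S U)) \<le> (\<Sum>s\<in>{1..r}. real (card (\<Union>(S, U)\<in>Q s. Bad S U)))"
      unfolding of_nat_sum[symmetric] of_nat_le_iff .
    also have "\<dots> \<le> (\<Sum>s\<in>{1..r}. real (n ^ (5 * m)) * (1/3) ^ s)"
    proof (rule sum_mono)
      fix s assume s: "s \<in> {1..r}"
      show "real (card (\<Union>(S, U)\<in>Q s. Bad S U)) \<le> real (n ^ (5 * m)) * (1/3) ^ s"
      proof (cases "s \<le> m")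
        case False
        then have "card (Q s) = 0" by (simp add: cardQ binomial_eq_0)
        then have "Q s = {}" using finQ by simp
        then show ?thesis by simp
      next
        case True
        have "card (\<Union>(S, U)\<in>Q s. Bad S U) \<le> (\<Sum>(S, U)\<in>Q s. card (Bad S U))"
          using card_UN_le[OF finQ, of "\<lambda>(S, U). Bad S U" s] by (simp add: case_prod_unfold)
        also have "\<dots> = (\<Sum>q\<in>Q s. (3 * s) ^ (5 * s) * n ^ (5 * (m - s)))"
          by (intro sum.cong) (auto simp: cardBad)
        also have "\<dots> = (m choose s) * (n choose (3 * s)) * (3 * s) ^ (5 * s) * n ^ (5 * (m - s))"
          by (simp add: cardQ)
        finally have "3 ^ s * card (\<Union>(S, U)\<in>Q s. Bad S U)
            \<le> 3 ^ s * ((m choose s) * (n choose (3 * s)) * (3 * s) ^ (5 * s)) * n ^ (5 * (m - s))"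
          by simp
        also have "\<dots> \<le> n ^ (5 * s) * n ^ (5 * (m - s))"
        proof (intro mult_right_mono expander_term_bound)
          have "2187 * m * s \<le> 2187 * (2 * n) * r" using assms s by (intro mult_mono) auto
          also have "\<dots> = 4374 * r * n" by simp
          also have "\<dots> \<le> n\<^sup>2" using assms by (simp add: power2_eq_square)
          finally show "2187 * m * s \<le> n\<^sup>2" .
        qed auto
        also have "\<dots> = n ^ (5 * m)" using True by (simp add: power_add[symmetric] algebra_simps)
        finally have "real (3 ^ s * card (\<Union>(S, U)\<in>Q s. Bad S U)) \<le> real (n ^ (5 * m))"
          by (simp only: of_nat_le_iff)
        then show ?thesis by (simp add: field_simps)
      qed
    qed
    finally show ?thesis .
  qed
  also have "\<dots> = real (n ^ (5 * m)) * (\<Sum>s\<in>{1..r}. (1/3) ^ s)" by (simp add: sum_distrib_left)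
  also have "(\<Sum>s\<in>{1..r}. (1/3::real) ^ s) = (1 - (1/3) ^ r) / 2"
  proof (induction r)
    case (Suc r)
    have "(1 - y) / 2 + y / 3 = (1 - y / 3) / 2" for y :: real by (simp add: field_simps)
    moreover have "(1/3::real) ^ Suc r = (1/3) ^ r / 3" by simp
    moreover have "(\<Sum>s\<in>{1..Suc r}. (1/3::real) ^ s) = (\<Sum>s\<in>{1..r}. (1/3) ^ s) + (1/3) ^ Suc r"
      by simp
    ultimately show ?case by (simp only: Suc.IH)
  qed simp
  also have "real (n ^ (5 * m)) * ((1 - (1/3) ^ r) / 2) < real (n ^ (5 * m)) * 1"
    using n0 by (intro mult_strict_left_mono) (auto simp: field_simps add_strict_increasing)
  finally have "card (\<Union>s\<in>{1..r}. \<Union>(S, U)\<in>Q s. Bad S U) < card Om" by (simp add: cardOm)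
  then have "\<not> Om \<subseteq> (\<Union>s\<in>{1..r}. \<Union>(S, U)\<in>Q s. Bad S U)"
  proof -
    have "finite (Bad S U)" if "(S, U) \<in> Q s" for S U s
    proof -
      have "finite U" using that finite_subset[of U "{..<n}"] by (simp add: Q_def)
      then show ?thesis unfolding Bad_def by (intro finite_PiE) auto
    qed
    then have "finite (\<Union>s\<in>{1..r}. \<Union>(S, U)\<in>Q s. Bad S U)" using finQ by auto
    then show ?thesis using \<open>card _ < card Om\<close> card_mono leD by metis
  qed
  then obtain F where F: "F \<in> Om" and good: "\<And>s S U. s \<in> {1..r} \<Longrightarrow> (S, U) \<in> Q s \<Longrightarrow> F \<notin> Bad S U"
    by blast
  define N where "N j = (\<lambda>t. F (j, t)) ` {..<5}" for j
  have sub: "N j \<subseteq> {..<n}" if "j < m" for j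
    using F that by (auto simp: N_def Om_def)
  show thesis
  proof
    fix S assume S: "S \<subseteq> {..<m}" "card S \<le> r"
    have finS: "finite S" using S finite_subset by blast
    let ?W = "\<Union>j\<in>S. N j"
    have W: "?W \<subseteq> {..<n}" using sub S by fastforce
    show "3 * card S \<le> card ?W"
    proof (rule ccontr)
      assume "\<not> 3 * card S \<le> card ?W"
      then have lt: "card ?W \<le> 3 * card S" and S1: "card S \<in> {1..r}" using S by auto
      \<comment> \<open>A union that is too small is padded to exactly \<open>3 * card S\<close>
        elements, the size of the targets in the union bound.\<close>
      have "3 * card S \<le> card {..<n}" using S assms by simp
      then obtain U where U: "?W \<subseteq> U" "U \<subseteq> {..<n}" "card U = 3 * card S"
        using exists_subset_between[OF lt _ W] by auto
      then have "(S, U) \<in> Q (card S)" using S by (auto simp: Q_def)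
      moreover have "F \<in> Bad S U"
        using F U(1) unfolding Bad_def Om_def N_def by (auto simp: PiE_iff)
      ultimately show False using good[OF S1] by blast
    qed
  next
    fix j assume "j < m"
    then show "N j \<subseteq> {..<n}" by (rule sub)
    show "N j \<noteq> {}" by (simp add: N_def lessThan_empty_iff)
    show "card (N j) \<le> 5" unfolding N_def using card_image_le[of "{..<5::nat}" "\<lambda>t. F (j, t)"] by simp
  qed
qed

section \<open>The uncoloured graph\<close>

text \<open>The theorem wants natural numbers as vertices, so a pair of a label and a finite set is
  coded by a number; every number decodes to such a pair.\<close>

definition lab :: "nat \<Rightarrow> nat" where "lab v = fst (prod_decode v)"
definition sub :: "nat \<Rightarrow> nat set" where "sub v = set_decode (snd (prod_decode v))"
definition mk :: "nat \<Rightarrow> nat set \<Rightarrow> nat" where "mk l A = prod_encode (l, set_encode A)"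

lemma lab_mk [simp]: "lab (mk l A) = l"
  by (simp add: lab_def mk_def)

lemma sub_mk [simp]: "finite A \<Longrightarrow> sub (mk l A) = A"
  by (simp add: sub_def mk_def)

lemma finite_sub [simp]: "finite (sub v)"
  by (simp add: sub_def)

lemma mk_lab_sub [simp]: "mk (lab v) (sub v) = v"
  by (simp add: lab_def sub_def mk_def)

lemma vertex_eqI: "lab v = lab w \<Longrightarrow> sub v = sub w \<Longrightarrow> v = w"
  by (metis mk_lab_sub)

text \<open>The Cai--Fuerer--Immerman construction for a system of equations over the two-element field:
  labels below \<^term>\<open>n::nat\<close> are variables, labels \<^term>\<open>l\<close> from \<^term>\<open>n\<close> to \<^term>\<open>n + m\<close> are equations
  with variable set \<^term>\<open>B l\<close>. A vertex is a label together with an assignment to its variables,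
  given as the set of variables with value 1; assignments of both parities are present. The remaining
  labels carry a single vertex each: \<^term>\<open>m + n\<close> rank vertices, a hub and a leaf, which serve only to
  make all labels definable.\<close>
locale cfi =
  fixes n m :: nat and B :: "nat \<Rightarrow> nat set"
  assumes n_pos: "0 < n" and m_pos: "0 < m"
    and B_sub: "\<And>j. n \<le> j \<Longrightarrow> j < n + m \<Longrightarrow> B j \<subseteq> {..<n}"
    and B_ne: "\<And>j. n \<le> j \<Longrightarrow> j < n + m \<Longrightarrow> B j \<noteq> {}"
    and B_card: "\<And>j. n \<le> j \<Longrightarrow> j < n + m \<Longrightarrow> card (B j) \<le> 5"
begin

text \<open>Treating a variable as its own sole variable and giving the auxiliary labels none makes
  all blocks uniform, with \<open>2 ^ card (N l)\<close> vertices each.\<close>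

definition N :: "nat \<Rightarrow> nat set" where
  "N l = (if l < n then {l} else if l < n + m then B l else {})"

definition hub where "hub = 2 * (n + m)"
definition leaf where "leaf = 2 * (n + m) + 1"

definition V :: "nat set" where
  "V = {v. lab v \<le> leaf \<and> sub v \<subseteq> N (lab v)}"

text \<open>The first disjunct is a half graph: rank \<open>n + m + t\<close> sees exactly the
  blocks from \<open>t\<close> on, so the label of a block is revealed by counting its rank
  neighbours.\<close>

definition rel0 :: "nat \<Rightarrow> nat \<Rightarrow> bool" where
  "rel0 l l' \<longleftrightarrow> (l < n + m \<and> n + m \<le> l' \<and> l' < hub \<and> l' \<le> n + m + l) \<or>
     (l < n + m \<and> l' = hub) \<or> (l = hub \<and> l' = leaf)"

definition inc0 :: "nat \<Rightarrow> nat \<Rightarrow> bool" where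
  "inc0 l l' \<longleftrightarrow> l < n \<and> n \<le> l' \<and> l' < n + m \<and> l \<in> N l'"

text \<open>For a variable and an equation containing it, the condition on the two sets says that
  both vertices give the variable the same value.\<close>

definition adj :: "nat \<Rightarrow> nat \<Rightarrow> bool" where
  "adj v w \<longleftrightarrow> rel0 (lab v) (lab w) \<or> rel0 (lab w) (lab v) \<or>
     (inc0 (lab v) (lab w) \<or> inc0 (lab w) (lab v)) \<and> sub v \<inter> N (lab w) = sub w \<inter> N (lab v)"

definition H :: "nat graph" where
  "H = \<lparr>verts = V, edges = {{v, w} | v w. v \<in> V \<and> w \<in> V \<and> adj v w}\<rparr>"

lemma verts_H [simp]: "verts H = V" by (simp add: H_def)

lemma adj_sym: "adj v w \<longleftrightarrow> adj w v"
  unfolding adj_def by auto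

lemma edges_H: "{v, w} \<in> edges H \<longleftrightarrow> v \<in> V \<and> w \<in> V \<and> adj v w"
  unfolding H_def using adj_sym by (auto simp: doubleton_eq_iff)

lemma N_subset: "N l \<subseteq> {..<n}"
  using B_sub by (auto simp: N_def)

lemma finite_N [simp]: "finite (N l)"
  using N_subset finite_subset by blast

lemma finite_N_sub [simp]: "A \<subseteq> N l \<Longrightarrow> finite A"
  using finite_N finite_subset by blast

lemma card_N_le: "card (N l) \<le> 5"
  using B_card by (auto simp: N_def)

lemma N_var [simp]: "l < n \<Longrightarrow> N l = {l}" by (simp add: N_def)

lemma N_other: "n + m \<le> l \<Longrightarrow> N l = {}" by (simp add: N_def)

lemma mk_in_V: "A \<subseteq> N l \<Longrightarrow> l \<le> leaf \<Longrightarrow> mk l A \<in> V"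
  by (simp add: V_def)

lemma mk_empty_in_V: "l \<le> leaf \<Longrightarrow> mk l {} \<in> V"
  by (simp add: V_def)

lemma block_eq: "l \<le> leaf \<Longrightarrow> {v \<in> V. lab v = l} = mk l ` Pow (N l)"
proof (intro set_eqI iffI)
  fix v assume "v \<in> {v \<in> V. lab v = l}"
  then show "v \<in> mk l ` Pow (N l)"
    using mk_lab_sub[of v] by (intro image_eqI[of _ _ "sub v"]) (auto simp: V_def simp del: mk_lab_sub)
qed (auto simp: V_def)

lemma card_block: "l \<le> leaf \<Longrightarrow> card {v \<in> V. lab v = l} = 2 ^ card (N l)"
proof -
  have "inj_on (mk l) (Pow (N l))"
    by (rule inj_onI) (metis PowD finite_N_sub sub_mk)
  then show "l \<le> leaf \<Longrightarrow> ?thesis" by (simp add: block_eq card_image card_Pow)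
qed

lemma V_eq: "V = (\<Union>l\<le>leaf. {v \<in> V. lab v = l})"
  by (auto simp: V_def)

lemma finite_V: "finite V"
proof -
  have "finite {v \<in> V. lab v = l}" if "l \<le> leaf" for l
    using that by (simp add: block_eq)
  then show ?thesis by (subst V_eq) auto
qed

text \<open>There are \<open>2 * (n + m) + 2\<close> labels and each block has at most
  \<open>2 ^ 5\<close> vertices.\<close>

lemma card_V_le: "card V \<le> 64 * (n + m + 1)"
proof -
  have "card V \<le> (\<Sum>l\<le>leaf. card {v \<in> V. lab v = l})"
    by (subst V_eq) (rule card_UN_le, simp)
  also have "\<dots> \<le> (\<Sum>l\<le>leaf. 2 ^ 5)"
    by (intro sum_mono) (auto simp: card_block intro!: power_increasing[of _ 5 2, simplified] card_N_le)
  finally show ?thesis by (simp add: leaf_def)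
qed

lemma is_graph_H: "is_graph H"
proof -
  have "v \<noteq> w" if "adj v w" for v w
    using that by (auto simp: adj_def rel0_def inc0_def hub_def leaf_def)
  then show ?thesis
    using finite_V by (auto simp: is_graph_def H_def card_insert_if)
qed

section \<open>Renaming values gives automorphisms\<close>

definition flip :: "nat set \<Rightarrow> nat \<Rightarrow> nat" where
  "flip f v = mk (lab v) (sym_diff (sub v) (f \<inter> N (lab v)))"

lemma lab_flip [simp]: "lab (flip f v) = lab v"
  by (simp add: flip_def)

lemma sub_flip [simp]: "sub (flip f v) = sym_diff (sub v) (f \<inter> N (lab v))"
  by (simp add: flip_def)

lemma flip_in_V [simp]: "v \<in> V \<Longrightarrow> flip f v \<in> V"
  by (auto simp: V_def)

lemma flip_flip [simp]: "flip f (flip f v) = v"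
  by (rule vertex_eqI) auto

lemma flip_cong: "f \<inter> N (lab v) = f' \<inter> N (lab v) \<Longrightarrow> flip f v = flip f' v"
  by (simp add: flip_def)

text \<open>Both sides of the agreement condition change on the same set, \<open>f\<close>
  restricted to the common variables, so agreement is kept.\<close>

lemma adj_flip:
  assumes "v \<in> V" "w \<in> V"
  shows "adj (flip f v) (flip f w) \<longleftrightarrow> adj v w"
proof -
  have "sub v \<subseteq> N (lab v)" "sub w \<subseteq> N (lab w)" using assms by (auto simp: V_def)
  then have "sub (flip f v) \<inter> N (lab w) = sub (flip f w) \<inter> N (lab v) \<longleftrightarrow>
      sub v \<inter> N (lab w) = sub w \<inter> N (lab v)"
    unfolding sub_flip by blast
  then show ?thesis by (simp add: adj_def)
qed

lemma graph_iso_flip: "graph_iso H H (flip f)"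
proof -
  have "bij_betw (flip f) V V" by (rule bij_betwI[where g = "flip f"]) auto
  then show ?thesis by (auto simp: graph_iso_def edges_H adj_flip)
qed

subsection \<open>Definability of the labels\<close>

text \<open>The kinds are peeled off from the only vertex of degree one: leaf, hub, blocks, and the
  ranks as the remainder. The definitions make sense in every graph, because they enter a sentence
  that is evaluated in other graphs as well.\<close>

definition is_leaf :: "nat graph \<Rightarrow> nat \<Rightarrow> bool" where
  "is_leaf G v \<longleftrightarrow> nbs G (\<lambda>_ _. True) v = 1"
definition is_hub :: "nat graph \<Rightarrow> nat \<Rightarrow> bool" where
  "is_hub G v \<longleftrightarrow> 1 \<le> nbs G is_leaf v"
definition is_block :: "nat graph \<Rightarrow> nat \<Rightarrow> bool" where
  "is_block G v \<longleftrightarrow> 1 \<le> nbs G is_hub v \<and> \<not> is_leaf G v"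
definition is_rank :: "nat graph \<Rightarrow> nat \<Rightarrow> bool" where
  "is_rank G v \<longleftrightarrow> \<not> is_leaf G v \<and> \<not> is_hub G v \<and> \<not> is_block G v"

text \<open>The degree of rank \<open>l\<close> into the blocks. It strictly decreases along the
  ranks and so separates them.\<close>

definition upper :: "nat \<Rightarrow> nat" where
  "upper l = card {w \<in> V. lab w < n + m \<and> l \<le> n + m + lab w}"

definition has_label :: "nat \<Rightarrow> nat graph \<Rightarrow> nat \<Rightarrow> bool" where
  "has_label l = (if l < n + m then (\<lambda>G v. is_block G v \<and> nbs G is_rank v = Suc l)
     else if l < hub then (\<lambda>G v. is_rank G v \<and> nbs G is_block v = upper l)
     else if l = hub then is_hub else is_leaf)"

lemma unary3_has_label: "unary3 (has_label l)"
proof -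
  have leaf: "unary3 is_leaf" unfolding is_leaf_def by (intro unary3_nbs unary3_true)
  have hub: "unary3 is_hub" unfolding is_hub_def by (intro unary3_nbs leaf)
  have block: "unary3 is_block" unfolding is_block_def
    by (intro unary3_conj unary3_not unary3_nbs leaf hub)
  have rank: "unary3 is_rank" unfolding is_rank_def
    by (intro unary3_conj unary3_not leaf hub block)
  show ?thesis unfolding has_label_def
    using leaf hub block rank by (auto intro!: unary3_conj unary3_nbs)
qed

lemma nbs_H: "v \<in> V \<Longrightarrow> nbs H D v = card {w \<in> V. adj v w \<and> D H w}"
  unfolding nbs_def verts_H by (rule arg_cong[where f = card]) (auto simp: edges_H)

lemma nbs_H_ge_1: "v \<in> V \<Longrightarrow> 1 \<le> nbs H D v \<longleftrightarrow> (\<exists>w\<in>V. adj v w \<and> D H w)"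
  using finite_V by (auto simp: nbs_H Suc_le_eq card_gt_0_iff)

lemma is_leaf_H: assumes "v \<in> V" shows "is_leaf H v \<longleftrightarrow> lab v = leaf"
proof -
  have two: "\<not> is_leaf H v" if "adj v a" "adj v b" "a \<noteq> b" "a \<in> V" "b \<in> V" for a b
  proof
    assume "is_leaf H v"
    then obtain c where "{w \<in> V. adj v w} = {c}"
      using assms by (auto simp: is_leaf_def nbs_H card_1_singleton_iff)
    moreover have "a \<in> {w \<in> V. adj v w}" "b \<in> {w \<in> V. adj v w}" using that by auto
    ultimately show False using \<open>a \<noteq> b\<close> by simp
  qed
  have le: "lab v \<le> leaf" using assms by (simp add: V_def)
  then consider "lab v < n + m" | "n + m \<le> lab v" "lab v < hub" | "lab v = hub" | "lab v = leaf"
    by (fastforce simp: hub_def leaf_def)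
  then show ?thesis
  proof cases
    case 1
    have "\<not> is_leaf H v"
      by (rule two[of "mk hub {}" "mk (n + m) {}"])
        (use 1 n_pos in \<open>auto simp: adj_def rel0_def hub_def leaf_def intro!: mk_empty_in_V dest: arg_cong[where f = lab]\<close>)
    then show ?thesis using 1 by (simp add: leaf_def)
  next
    case 2
    \<comment> \<open>The last equation is joined to every rank, and since it contains a variable
      its block supplies two neighbours.\<close>
    let ?j = "n + m - 1"
    have j: "n \<le> ?j" "?j < n + m" using m_pos by auto
    then obtain x where x: "x \<in> N ?j" using B_ne[of ?j] by (auto simp: N_def)
    have "\<not> is_leaf H v"
      by (rule two[of "mk ?j {}" "mk ?j {x}"])
        (use 2 j x in \<open>auto simp: adj_def rel0_def hub_def leaf_def intro!: mk_empty_in_V mk_in_V dest: arg_cong[where f = sub]\<close>)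
    then show ?thesis using 2 by (simp add: leaf_def hub_def)
  next
    case 3
    have "\<not> is_leaf H v"
      by (rule two[of "mk leaf {}" "mk 0 {}"])
        (use 3 n_pos in \<open>auto simp: adj_def rel0_def hub_def leaf_def intro!: mk_empty_in_V dest: arg_cong[where f = lab]\<close>)
    then show ?thesis using 3 by (simp add: leaf_def hub_def)
  next
    case 4
    have "{w \<in> V. adj v w} = {w \<in> V. lab w = hub}"
      using 4 by (auto simp: adj_def rel0_def hub_def leaf_def inc0_def)
    then show ?thesis using 4 assms card_block[of hub]
      by (simp add: is_leaf_def nbs_H leaf_def hub_def N_other)
  qed
qed

lemma is_hub_H: assumes "v \<in> V" shows "is_hub H v \<longleftrightarrow> lab v = hub"
proof -
  have "is_hub H v \<longleftrightarrow> (\<exists>w\<in>V. adj v w \<and> lab w = leaf)"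
    unfolding is_hub_def nbs_H_ge_1[OF assms] using is_leaf_H by auto
  also have "\<dots> \<longleftrightarrow> lab v = hub"
  proof
    assume "lab v = hub"
    then show "\<exists>w\<in>V. adj v w \<and> lab w = leaf"
      by (intro bexI[of _ "mk leaf {}"]) (auto simp: adj_def rel0_def mk_empty_in_V)
  qed (auto simp: adj_def rel0_def inc0_def hub_def leaf_def)
  finally show ?thesis .
qed

lemma is_block_H: assumes "v \<in> V" shows "is_block H v \<longleftrightarrow> lab v < n + m"
proof -
  have "is_block H v \<longleftrightarrow> (\<exists>w\<in>V. adj v w \<and> lab w = hub) \<and> lab v \<noteq> leaf"
    unfolding is_block_def nbs_H_ge_1[OF assms] using assms is_hub_H is_leaf_H by auto
  also have "\<dots> \<longleftrightarrow> lab v < n + m"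
  proof
    assume "lab v < n + m"
    then show "(\<exists>w\<in>V. adj v w \<and> lab w = hub) \<and> lab v \<noteq> leaf"
      by (intro conjI bexI[of _ "mk hub {}"])
        (auto simp: adj_def rel0_def mk_empty_in_V leaf_def hub_def)
  qed (auto simp: adj_def rel0_def inc0_def hub_def leaf_def)
  finally show ?thesis .
qed

lemma is_rank_H: assumes "v \<in> V" shows "is_rank H v \<longleftrightarrow> n + m \<le> lab v \<and> lab v < hub"
proof -
  have "lab v \<le> leaf" using assms by (simp add: V_def)
  then show ?thesis
    unfolding is_rank_def is_hub_H[OF assms] is_leaf_H[OF assms] is_block_H[OF assms]
    by (auto simp: hub_def leaf_def)
qed

lemma upper_less:
  assumes "l < l'" "n + m \<le> l" "l' < hub"
  shows "upper l' < upper l"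
  unfolding upper_def
proof (rule psubset_card_mono)
  \<comment> \<open>The block with this label is joined to rank \<open>l\<close> but to no higher
    rank.\<close>
  let ?w = "mk (l - (n + m)) {}"
  have "?w \<in> {w \<in> V. lab w < n + m \<and> l \<le> n + m + lab w}"
    "?w \<notin> {w \<in> V. lab w < n + m \<and> l' \<le> n + m + lab w}"
    using assms by (auto simp: hub_def leaf_def intro: mk_empty_in_V)
  moreover have "{w \<in> V. lab w < n + m \<and> l' \<le> n + m + lab w} \<subseteq> {w \<in> V. lab w < n + m \<and> l \<le> n + m + lab w}"
    using assms by auto
  ultimately show "{w \<in> V. lab w < n + m \<and> l' \<le> n + m + lab w} \<subset> {w \<in> V. lab w < n + m \<and> l \<le> n + m + lab w}"
    by blast
qed (use finite_V in simp)

lemma upper_inj: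
  "n + m \<le> l \<Longrightarrow> l < hub \<Longrightarrow> n + m \<le> l' \<Longrightarrow> l' < hub \<Longrightarrow> upper l = upper l' \<longleftrightarrow> l = l'"
  using upper_less[of l l'] upper_less[of l' l] by (cases l l' rule: linorder_cases) auto

lemma has_label_H:
  assumes "v \<in> V" "l \<le> leaf"
  shows "has_label l H v \<longleftrightarrow> lab v = l"
proof -
  have rank: "nbs H is_rank v = Suc (lab v)" if "lab v < n + m"
  proof -
    have "{w \<in> V. adj v w \<and> is_rank H w} = {w \<in> V. n + m \<le> lab w \<and> lab w \<le> n + m + lab v}"
      using that by (auto simp: is_rank_H adj_def rel0_def inc0_def hub_def leaf_def)
    also have "\<dots> = (\<lambda>t. mk t {}) ` {n + m..n + m + lab v}"
    proof (intro set_eqI iffI)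
      fix w assume w: "w \<in> {w \<in> V. n + m \<le> lab w \<and> lab w \<le> n + m + lab v}"
      then have "w = mk (lab w) {}" by (intro vertex_eqI[of w "mk (lab w) {}"]) (auto simp: V_def N_other)
      then show "w \<in> (\<lambda>t. mk t {}) ` {n + m..n + m + lab v}" using w by auto
    qed (use that in \<open>auto simp: leaf_def intro!: mk_empty_in_V\<close>)
    finally have "{w \<in> V. adj v w \<and> is_rank H w} = (\<lambda>t. mk t {}) ` {n + m..n + m + lab v}" .
    moreover have "inj_on (\<lambda>t. mk t {}) {n + m..n + m + lab v}" by (rule inj_onI) (metis lab_mk)
    ultimately show ?thesis using assms by (simp add: nbs_H card_image)
  qed
  have block: "nbs H is_block v = upper (lab v)" if "n + m \<le> lab v" "lab v < hub"
  proof -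
    have "{w \<in> V. adj v w \<and> is_block H w} = {w \<in> V. lab w < n + m \<and> lab v \<le> n + m + lab w}"
      using that by (auto simp: is_block_H adj_def rel0_def inc0_def hub_def leaf_def)
    then show ?thesis using assms by (simp add: nbs_H upper_def)
  qed
  consider "l < n + m" | "n + m \<le> l" "l < hub" | "l = hub" | "l = leaf"
    using assms(2) by (fastforce simp: hub_def leaf_def)
  then show ?thesis
  proof cases
    case 1
    then show ?thesis using rank assms by (auto simp: has_label_def is_block_H)
  next
    case 2
    then show ?thesis using block assms upper_inj[of l "lab v"]
      by (auto simp: has_label_def is_rank_H)
  qed (use assms in \<open>auto simp: has_label_def is_hub_H is_leaf_H hub_def leaf_def\<close>)
qed

subsection \<open>Identification by three variables\<close>

definition rel :: "nat \<Rightarrow> nat \<Rightarrow> bool" where "rel l l' \<longleftrightarrow> rel0 l l' \<or> rel0 l' l"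
definition inc :: "nat \<Rightarrow> nat \<Rightarrow> bool" where "inc l l' \<longleftrightarrow> inc0 l l' \<or> inc0 l' l"

lemma adj_rel: "\<not> inc (lab v) (lab w) \<Longrightarrow> adj v w \<longleftrightarrow> rel (lab v) (lab w)"
  by (auto simp: adj_def rel_def inc_def)

lemma adj_inc:
  assumes "inc0 (lab v) (lab w)" "v \<in> V" "w \<in> V"
  shows "adj v w \<longleftrightarrow> (lab v \<in> sub v \<longleftrightarrow> lab v \<in> sub w)"
proof -
  have x: "lab v < n" "n \<le> lab w" "lab w < n + m" "lab v \<in> N (lab w)"
    using assms(1) by (auto simp: inc0_def)
  then have "adj v w \<longleftrightarrow> sub v \<inter> N (lab w) = sub w \<inter> {lab v}"
    using assms(1) by (auto simp: adj_def rel0_def hub_def leaf_def)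
  moreover have "sub v \<subseteq> {lab v}" using assms(2) x by (auto simp: V_def)
  ultimately show ?thesis using x(4) by blast
qed

text \<open>An axiomatisation of \<open>H\<close>. Once a vertex of each variable block is declared
  to mean 0, unique neighbours turn equation vertices into assignments, the last clause makes this
  decoding injective, and the block sizes force every assignment to occur.\<close>

definition shape :: "nat graph \<Rightarrow> bool" where
  "shape G \<longleftrightarrow>
     (\<forall>v\<in>verts G. \<exists>l\<in>{..leaf}. has_label l G v) \<and>
     (\<forall>l\<in>{..leaf}. \<forall>l'\<in>{..leaf}. \<forall>v\<in>verts G. has_label l G v \<and> has_label l' G v \<longrightarrow> l = l') \<and>
     (\<forall>l\<in>{..leaf}. card {v \<in> verts G. has_label l G v} = 2 ^ card (N l)) \<and>
     (\<forall>l\<in>{..leaf}. \<forall>l'\<in>{..leaf}. \<forall>v\<in>verts G. \<forall>w\<in>verts G.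
        has_label l G v \<and> has_label l' G w \<longrightarrow> \<not> inc l l' \<longrightarrow> ({v, w} \<in> edges G \<longleftrightarrow> rel l l')) \<and>
     (\<forall>j\<in>{n..<n + m}. \<forall>x\<in>N j. \<forall>v\<in>verts G. has_label j G v \<longrightarrow> nbs G (has_label x) v = 1) \<and>
     (\<forall>j\<in>{n..<n + m}. \<forall>v\<in>verts G. \<forall>v'\<in>verts G. has_label j G v \<and> has_label j G v' \<longrightarrow> v \<noteq> v' \<longrightarrow>
        (\<exists>x\<in>N j. \<exists>w\<in>verts G. has_label x G w \<and> ({v, w} \<in> edges G \<longleftrightarrow> {v', w} \<notin> edges G)))"

lemma expr3_shape: "expr3 {} (\<lambda>G a. shape G)"
proof -
  have e1: "expr3 {} (\<lambda>G a. \<forall>v\<in>verts G. \<exists>l\<in>{..leaf}. has_label l G v)"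
    using expr3_all[of 0 "{}" "\<lambda>G a. \<exists>l\<in>{..leaf}. has_label l G (a 0)",
        OF _ expr3_bex[OF _ expr3_unary[OF unary3_has_label]]] by simp
  have e2: "expr3 {} (\<lambda>G a. \<forall>v\<in>verts G. has_label l G v \<and> has_label l' G v \<longrightarrow> l = l')" for l l'
    using expr3_all[of 0 "{}" "\<lambda>G a. has_label l G (a 0) \<and> has_label l' G (a 0) \<longrightarrow> l = l'",
        OF _ expr3_imp[OF expr3_conj[OF expr3_unary[OF unary3_has_label] expr3_unary[OF unary3_has_label]]
          expr3_const]] by simp
  have e3: "expr3 {} (\<lambda>G a. card {v \<in> verts G. has_label l G v} = 2 ^ card (N l))" for l
    using expr3_card_eq[of 0 "{}" "\<lambda>G a. has_label l G (a 0)",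
        OF _ expr3_unary[OF unary3_has_label]] by simp
  have e4: "expr3 {} (\<lambda>G a. \<forall>v\<in>verts G. \<forall>w\<in>verts G.
        has_label l G v \<and> has_label l' G w \<longrightarrow> \<not> inc l l' \<longrightarrow> ({v, w} \<in> edges G \<longleftrightarrow> rel l l'))" for l l'
  proof -
    have "expr3 {1, 0} (\<lambda>G a. has_label l G (a 0) \<and> has_label l' G (a 1) \<longrightarrow> \<not> inc l l' \<longrightarrow>
        ({a 0, a 1} \<in> edges G \<longleftrightarrow> rel l l'))"
      by (intro expr3_imp expr3_conj expr3_iff expr3_adj expr3_const expr3_unary unary3_has_label) auto
    from expr3_all[OF _ expr3_all[OF _ this]] show ?thesis by simp
  qed
  have e5: "expr3 {} (\<lambda>G a. \<forall>v\<in>verts G. has_label j G v \<longrightarrow> nbs G (has_label x) v = 1)" for j x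
    using expr3_all[of 0 "{}" "\<lambda>G a. has_label j G (a 0) \<longrightarrow> nbs G (has_label x) (a 0) = 1",
        OF _ expr3_imp[OF expr3_unary[OF unary3_has_label]
          expr3_unary[OF unary3_nbs(1)[OF unary3_has_label]]]] by simp
  have e6: "expr3 {} (\<lambda>G a. \<forall>v\<in>verts G. \<forall>v'\<in>verts G. has_label j G v \<and> has_label j G v' \<longrightarrow>
      v \<noteq> v' \<longrightarrow> (\<exists>x\<in>N j. \<exists>w\<in>verts G. has_label x G w \<and> ({v, w} \<in> edges G \<longleftrightarrow> {v', w} \<notin> edges G)))" for j
  proof -
    \<comment> \<open>Only here are three variables live at once: two vertices of a block and a
      variable vertex separating them.\<close>
    have "expr3 {2, 1, 0} (\<lambda>G a. has_label x G (a 2) \<and>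
        ({a 0, a 2} \<in> edges G \<longleftrightarrow> {a 1, a 2} \<notin> edges G))" for x
      by (intro expr3_conj expr3_iff expr3_not expr3_adj expr3_unary unary3_has_label) auto
    from expr3_ex[OF _ this]
    have "expr3 {1, 0} (\<lambda>G a. \<exists>w\<in>verts G. has_label x G w \<and>
        ({a 0, w} \<in> edges G \<longleftrightarrow> {a 1, w} \<notin> edges G))" for x by simp
    then have "expr3 {1, 0} (\<lambda>G a. has_label j G (a 0) \<and> has_label j G (a 1) \<longrightarrow> \<not> a 0 = a 1 \<longrightarrow>
        (\<exists>x\<in>N j. \<exists>w\<in>verts G. has_label x G w \<and> ({a 0, w} \<in> edges G \<longleftrightarrow> {a 1, w} \<notin> edges G)))"
      by (intro expr3_imp expr3_conj expr3_not expr3_eq expr3_bex expr3_unary unary3_has_label) auto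
    from expr3_all[OF _ expr3_all[OF _ this]] show ?thesis by simp
  qed
  show ?thesis unfolding shape_def
    by (intro expr3_conj expr3_ball e1 e2 e3 e4 e5 e6) auto
qed

lemma shape_H: "shape H"
  unfolding shape_def verts_H
proof (intro conjI ballI impI)
  fix v assume "v \<in> V"
  then show "\<exists>l\<in>{..leaf}. has_label l H v"
    by (intro bexI[of _ "lab v"]) (auto simp: has_label_H V_def)
next
  fix l assume "l \<in> {..leaf}"
  then have "{v \<in> V. has_label l H v} = {v \<in> V. lab v = l}" by (auto simp: has_label_H)
  then show "card {v \<in> V. has_label l H v} = 2 ^ card (N l)"
    using \<open>l \<in> _\<close> by (simp add: card_block)
next
  fix j x v assume "j \<in> {n..<n + m}" "x \<in> N j" "v \<in> V" "has_label j H v"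
  then have v: "v \<in> V" "lab v = j" and j: "n \<le> j" "j < n + m" and x: "x \<in> N j" "x < n"
    using N_subset by (fastforce simp: has_label_H leaf_def)+
  have x': "x \<le> leaf" using x by (simp add: leaf_def)
  \<comment> \<open>The only neighbour is the vertex recording the value of \<open>x\<close> in
    \<open>v\<close>.\<close>
  have "{w \<in> V. adj v w \<and> has_label x H w} = {mk x (sub v \<inter> {x})}"
  proof (intro set_eqI iffI)
    fix w assume w: "w \<in> {w \<in> V. adj v w \<and> has_label x H w}"
    then have "lab w = x" using x' by (auto simp: has_label_H)
    moreover have "sub w = sub v \<inter> {x}"
      using w adj_inc[of w v] v x j \<open>lab w = x\<close> by (auto simp: adj_sym inc0_def V_def)
    ultimately show "w \<in> {mk x (sub v \<inter> {x})}" using mk_lab_sub[of w] by simp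
  next
    fix w assume w: "w \<in> {mk x (sub v \<inter> {x})}"
    then have "w \<in> V" "lab w = x" using x' x by (auto intro: mk_in_V)
    moreover have "adj w v" using w v x j calculation by (subst adj_inc) (auto simp: inc0_def)
    ultimately show "w \<in> {w \<in> V. adj v w \<and> has_label x H w}" using x' by (simp add: has_label_H adj_sym)
  qed
  then show "nbs H (has_label x) v = 1" using v by (simp add: nbs_H)
next
  fix j v v' assume "j \<in> {n..<n + m}" "v \<in> V" "v' \<in> V" "has_label j H v \<and> has_label j H v'" "v \<noteq> v'"
  then have v: "v \<in> V" "lab v = j" "v' \<in> V" "lab v' = j" "sub v \<noteq> sub v'" and j: "n \<le> j" "j < n + m"
    using vertex_eqI[of v v'] by (auto simp: has_label_H leaf_def)
  then obtain x where x: "x \<in> N j" "x \<in> sub v \<longleftrightarrow> x \<notin> sub v'"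
    by (auto simp: V_def)
  then have x': "x < n" using N_subset by auto
  \<comment> \<open>The 0-vertex of a variable on which the assignments differ sees exactly one of
    \<open>v\<close> and \<open>v'\<close>.\<close>
  let ?w = "mk x {}"
  have w: "?w \<in> V" "lab ?w = x" using x' by (auto intro: mk_empty_in_V simp: leaf_def)
  have "adj ?w v \<longleftrightarrow> \<not> adj ?w v'"
    using v w x x' j by (simp add: adj_inc inc0_def)
  then show "\<exists>x\<in>N j. \<exists>w\<in>V. has_label x H w \<and> ({v, w} \<in> edges H \<longleftrightarrow> {v', w} \<notin> edges H)"
    using v w x x' by (intro bexI[of _ x] bexI[of _ ?w])
      (auto simp: edges_H adj_sym has_label_H leaf_def)
next
  fix l l' v assume "l \<in> {..leaf}" "l' \<in> {..leaf}" "v \<in> V" "has_label l H v \<and> has_label l' H v"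
  then show "l = l'" by (auto simp: has_label_H)
next
  fix l l' v w assume "l \<in> {..leaf}" "l' \<in> {..leaf}" "v \<in> V" "w \<in> V"
    "has_label l H v \<and> has_label l' H w" "\<not> inc l l'"
  then have "lab v = l" "lab w = l'" "v \<in> V" "w \<in> V" "\<not> inc l l'" by (auto simp: has_label_H)
  then show "{v, w} \<in> edges H \<longleftrightarrow> rel l l'" using adj_rel by (simp add: edges_H)
qed

text \<open>A model of \<open>shape\<close> is decoded block by block into labels and assignments;
  the decoding \<open>g\<close> is an isomorphism onto \<open>H\<close>, and its inverse is the
  required map.\<close>

lemma shape_iso:
  assumes G: "is_graph G" "shape G"
  shows "\<exists>f. graph_iso H G f"
proof -
  let ?P = "verts G"
  have finP: "finite ?P" using G by (simp add: is_graph_def)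
  note S = G(2)[unfolded shape_def]
  define lb where "lb v = (SOME l. l \<le> leaf \<and> has_label l G v)" for v
  have lb: "lb v \<le> leaf" "has_label (lb v) G v" if "v \<in> ?P" for v
  proof -
    have "\<exists>l. l \<le> leaf \<and> has_label l G v" using S that by blast
    from someI_ex[OF this] show "lb v \<le> leaf" "has_label (lb v) G v" by (auto simp: lb_def)
  qed
  have has: "has_label l G v \<longleftrightarrow> lb v = l" if "v \<in> ?P" "l \<le> leaf" for l v
    using S lb[OF that(1)] that by blast
  define blk where "blk l = {v \<in> ?P. lb v = l}" for l
  have card_blk: "card (blk l) = 2 ^ card (N l)" if "l \<le> leaf" for l
  proof -
    have "blk l = {v \<in> ?P. has_label l G v}" using that has by (auto simp: blk_def)
    then show ?thesis using S that by auto
  qed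
  \<comment> \<open>An arbitrary vertex of block \<open>x\<close> is taken as value 0; the choice is
    harmless because flips of \<open>H\<close> exchange the two values.\<close>
  define e where "e x = (SOME w. w \<in> blk x)" for x
  have var_le: "x < n \<Longrightarrow> x \<le> leaf" for x by (simp add: leaf_def)
  have e: "e x \<in> blk x" if "x < n" for x
  proof -
    have "blk x \<noteq> {}" using card_blk[OF var_le[OF that]] by force
    then show ?thesis unfolding e_def by (simp add: some_in_eq)
  qed
  have two: "w = w'" if "x < n" "w \<in> blk x" "w' \<in> blk x" "w \<noteq> e x" "w' \<noteq> e x" for x w w'
  proof (rule ccontr)
    assume "w \<noteq> w'"
    then have "card {w, w', e x} = 3" using that by auto
    moreover have "card {w, w', e x} \<le> card (blk x)"
      using that e finP by (intro card_mono) (auto simp: blk_def)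
    ultimately show False using card_blk[OF var_le[OF that(1)]] that by simp
  qed
  \<comment> \<open>An equation vertex gives \<open>x\<close> the value 1 exactly if it misses the
    0-vertex, in accordance with adjacency by equal values.\<close>
  define val where "val v = {x \<in> N (lb v). if lb v < n then v \<noteq> e x else {v, e x} \<notin> edges G}" for v
  have val_edge: "{v, w} \<in> edges G \<longleftrightarrow> (if w = e x then x \<notin> val v else x \<in> val v)"
    if v: "v \<in> ?P" "n \<le> lb v" "lb v < n + m" and x: "x \<in> N (lb v)" and w: "w \<in> blk x" for v w x
  proof -
    have xn: "x < n" using x N_subset by auto
    have "nbs G (has_label x) v = 1" using S v x lb(2)[OF v(1)] by auto
    moreover have "{w \<in> ?P. {v, w} \<in> edges G \<and> has_label x G w} = {w \<in> blk x. {v, w} \<in> edges G}"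
      using has var_le[OF xn] by (auto simp: blk_def)
    ultimately have "card {w \<in> blk x. {v, w} \<in> edges G} = 1" by (simp add: nbs_def)
    then obtain u where u: "{w \<in> blk x. {v, w} \<in> edges G} = {u}" by (auto simp: card_1_singleton_iff)
    have u_iff: "{v, w'} \<in> edges G \<longleftrightarrow> w' = u" if "w' \<in> blk x" for w'
      using u that by blast
    have "u \<in> blk x" using u by blast
    then have "{v, w} \<in> edges G \<longleftrightarrow> (if w = e x then {v, e x} \<in> edges G else {v, e x} \<notin> edges G)"
      using u_iff[OF w] u_iff[OF e[OF xn]] two[OF xn w] by auto
    then show ?thesis using v x by (simp add: val_def)
  qed
  define g where "g v = mk (lb v) (val v)" for v
  have val_sub: "val v \<subseteq> N (lb v)" for v by (auto simp: val_def)
  have "finite (val v)" for v using val_sub finite_N_sub by blast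
  then have lab_g [simp]: "lab (g v) = lb v" and sub_g [simp]: "sub (g v) = val v" for v
    by (auto simp: g_def)
  have g_V: "g v \<in> V" if "v \<in> ?P" for v
    using lb(1)[OF that] val_sub by (simp add: V_def)
  have g_inj: "inj_on g ?P"
  proof (rule inj_onI)
    fix v v' assume v: "v \<in> ?P" "v' \<in> ?P" and "g v = g v'"
    then have l: "lb v' = lb v" and s: "val v' = val v" by (metis lab_g, metis sub_g)
    consider "lb v < n" | "n \<le> lb v" "lb v < n + m" | "n + m \<le> lb v" by linarith
    then show "v = v'"
    proof cases
      case 1
      have "v = e (lb v) \<longleftrightarrow> v' = e (lb v)"
        using s 1 l by (auto simp: val_def)
      then show ?thesis using two[OF 1, of v v'] v l by (auto simp: blk_def)
    next
      case 2
      show ?thesis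
      proof (rule ccontr)
        assume "v \<noteq> v'"
        then have "\<exists>x\<in>N (lb v). \<exists>w\<in>?P. has_label x G w \<and> ({v, w} \<in> edges G \<longleftrightarrow> {v', w} \<notin> edges G)"
          using S v 2 l lb(2)[OF v(1)] lb(2)[OF v(2)] by auto
        then obtain x w where x: "x \<in> N (lb v)" and w: "w \<in> ?P" "has_label x G w"
          and ne: "{v, w} \<in> edges G \<longleftrightarrow> {v', w} \<notin> edges G" by blast
        then have "x < n" using N_subset by auto
        then have "w \<in> blk x" using w has var_le by (simp add: blk_def)
        then have "{v, w} \<in> edges G \<longleftrightarrow> {v', w} \<in> edges G"
          using val_edge[of v x w] val_edge[of v' x w] v 2 l x s by simp
        then show False using ne by blast
      qed
    next
      case 3
      then have "card (blk (lb v)) = 1" using card_blk[OF lb(1)[OF v(1)]] by (simp add: N_other)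
      then obtain u where "blk (lb v) = {u}" by (auto simp: card_1_singleton_iff)
      moreover have "v \<in> blk (lb v)" "v' \<in> blk (lb v)" using v l by (auto simp: blk_def)
      ultimately show ?thesis by simp
    qed
  qed
  have g_surj: "g ` ?P = V"
  proof
    show "V \<subseteq> g ` ?P"
    proof
      fix u assume u: "u \<in> V"
      then have l: "lab u \<le> leaf" by (simp add: V_def)
      \<comment> \<open>Injectivity and equal block sizes give surjectivity.\<close>
      have "g ` blk (lab u) = {v \<in> V. lab v = lab u}"
      proof (rule card_subset_eq)
        have "inj_on g (blk (lab u))" using g_inj by (rule inj_on_subset) (auto simp: blk_def)
        then show "card (g ` blk (lab u)) = card {v \<in> V. lab v = lab u}"
          using l by (simp add: card_image card_blk card_block)
      qed (use finite_V g_V in \<open>auto simp: blk_def\<close>)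
      then have "u \<in> g ` blk (lab u)" using u by auto
      then show "u \<in> g ` ?P" by (auto simp: blk_def)
    qed
  qed (use g_V in auto)
  have inc_case: "{v, w} \<in> edges G \<longleftrightarrow> adj (g v) (g w)"
    if v: "v \<in> ?P" "w \<in> ?P" and i: "inc0 (lb v) (lb w)" for v w
  proof -
    have x: "lb v < n" "n \<le> lb w" "lb w < n + m" "lb v \<in> N (lb w)" using i by (auto simp: inc0_def)
    have "{w, v} \<in> edges G \<longleftrightarrow> (if v = e (lb v) then lb v \<notin> val w else lb v \<in> val w)"
      using v x by (intro val_edge) (auto simp: blk_def)
    moreover have "lb v \<in> val v \<longleftrightarrow> v \<noteq> e (lb v)" using x by (auto simp: val_def)
    moreover have "adj (g v) (g w) \<longleftrightarrow> (lb v \<in> val v \<longleftrightarrow> lb v \<in> val w)"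
      using adj_inc[of "g v" "g w"] i v g_V by simp
    ultimately show ?thesis by (auto simp: insert_commute)
  qed
  have g_edge: "{v, w} \<in> edges G \<longleftrightarrow> {g v, g w} \<in> edges H" if v: "v \<in> ?P" "w \<in> ?P" for v w
  proof (cases "inc (lb v) (lb w)")
    case True
    then show ?thesis
      using inc_case[OF v] inc_case[OF v(2,1)] v g_V adj_sym by (auto simp: inc_def edges_H insert_commute)
  next
    case False
    then have "{v, w} \<in> edges G \<longleftrightarrow> rel (lb v) (lb w)"
      using S v lb by auto
    then show ?thesis using False v g_V by (simp add: edges_H adj_rel)
  qed
  have bij: "bij_betw g ?P V" using g_inj g_surj by (simp add: bij_betw_def)
  have "graph_iso H G (inv_into ?P g)"
    unfolding graph_iso_def verts_H
  proof (intro conjI ballI)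
    show "bij_betw (inv_into ?P g) V ?P" by (rule bij_betw_inv_into[OF bij])
    fix u v assume "u \<in> V" "v \<in> V"
    then show "{u, v} \<in> edges H \<longleftrightarrow> {inv_into ?P g u, inv_into ?P g v} \<in> edges G"
      using g_surj by (simp add: g_edge inv_into_into f_inv_into_f)
  qed
  then show ?thesis by blast
qed

lemma identified_H: "identified 3 H"
proof -
  obtain p where p: "p \<in> Ck 3" "free_vars p = {}" "\<And>G a. is_graph G \<Longrightarrow> sat G a p = shape G"
    using expr3_shape unfolding expr3_def by blast
  show ?thesis unfolding identified_def
    by (rule bexI[OF _ p(1)]) (use p is_graph_H shape_H shape_iso in auto)
qed

lemma vtype_H_lab:
  assumes "3 \<le> k" "v \<in> V" "w \<in> V" "vtype k H v = vtype k H w"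
  shows "lab v = lab w"
proof -
  have l: "lab v \<le> leaf" using assms by (simp add: V_def)
  have "expr3 {0} (\<lambda>G a. has_label (lab v) G (a 0))"
    by (intro expr3_unary unary3_has_label) auto
  then obtain p where p: "p \<in> Ck 3" "free_vars p \<subseteq> {0}"
    "\<And>G a. is_graph G \<Longrightarrow> sat G a p = has_label (lab v) G (a 0)"
    unfolding expr3_def by blast
  then have "p \<in> Ck k" using assms(1) by (auto simp: Ck_def cCk_def)
  moreover have "sat H (\<lambda>_. v) p" using p(3)[OF is_graph_H] assms(2) l by (simp add: has_label_H)
  ultimately have "p \<in> vtype k H w" using p assms(4) by (auto simp: vtype_def)
  then show ?thesis using p(3)[OF is_graph_H] assms(3) l by (simp add: vtype_def has_label_H)
qed

text \<open>Orbits lie within type classes and type classes within blocks; flips are transitive on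
  each block, so all three coincide.\<close>

lemma Ck_partition_H:
  assumes "3 \<le> k"
  shows "Ck_partition k H = orbits H"
proof -
  have "{w \<in> V. vtype k H w = vtype k H v} = {f v |f. graph_iso H H f}" if v: "v \<in> V" for v
  proof (intro set_eqI iffI)
    fix w assume w: "w \<in> {w \<in> V. vtype k H w = vtype k H v}"
    then have l: "lab w = lab v" using vtype_H_lab[OF assms, of w v] v by simp
    \<comment> \<open>Exactly the variables on which the two assignments differ are flipped.\<close>
    have "flip (sym_diff (sub v) (sub w)) v = w"
      by (rule vertex_eqI) (use l v w in \<open>auto simp: V_def\<close>)
    then show "w \<in> {f v |f. graph_iso H H f}"
      using graph_iso_flip by (auto intro!: exI[of _ "flip (sym_diff (sub v) (sub w))"])
  next
    fix w assume "w \<in> {f v |f. graph_iso H H f}"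
    then obtain f where f: "graph_iso H H f" "w = f v" by blast
    then have "w \<in> V" using v by (auto simp: graph_iso_def bij_betw_def)
    then show "w \<in> {w \<in> V. vtype k H w = vtype k H v}"
      using vtype_graph_iso[OF f(1)] f v by simp
  qed
  then show ?thesis unfolding Ck_partition_def orbits_def by (simp cong: image_cong)
qed

end

section \<open>The coloured graph\<close>

text \<open>Partial solutions. A set \<^term>\<open>f\<close> of variables (those with value 1) is consistent on \<^term>\<open>U\<close> if it
  satisfies every sum of at most \<^term>\<open>2 * K\<close> equations that mentions only variables of \<^term>\<open>U\<close>;
  the right-hand side of equation \<^term>\<open>j\<close> is 1 iff \<^term>\<open>j \<in> b\<close>.\<close>
locale cfi_expander = cfi +
  fixes K :: nat
  assumes expand: "\<And>S. S \<subseteq> {n..<n + m} \<Longrightarrow> card S \<le> 2 * K \<Longrightarrow> card S \<le> card (osupp N S)"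
begin

definition consistent :: "nat set \<Rightarrow> nat set \<Rightarrow> nat set \<Rightarrow> bool" where
  "consistent b f U \<longleftrightarrow> (\<forall>S\<subseteq>{n..<n + m}. card S \<le> 2 * K \<longrightarrow> osupp N S \<subseteq> U \<longrightarrow>
     (odd (card (f \<inter> osupp N S)) \<longleftrightarrow> odd (card (S \<inter> b))))"

lemma consistent_subset: "consistent b f U \<Longrightarrow> U' \<subseteq> U \<Longrightarrow> consistent b f U'"
  unfolding consistent_def by blast

text \<open>By expansion a nonempty small set of equations has nonempty support, so no small sum
  reads 0 = 1.\<close>

lemma consistent_empty: "consistent b {} {}"
  unfolding consistent_def
proof (intro allI impI)
  fix S assume S: "S \<subseteq> {n..<n + m}" "card S \<le> 2 * K" "osupp N S \<subseteq> {}"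
  then have "card S = 0" using expand[of S] by simp
  then have "S = {}" using S finite_subset by fastforce
  then show "odd (card ({} \<inter> osupp N S)) \<longleftrightarrow> odd (card (S \<inter> b))" by simp
qed

text \<open>By expansion, two sums of equations that both mention the new variable have at most \<^term>\<open>K\<close>
  terms each, so their difference is already controlled on \<^term>\<open>U\<close>.\<close>
lemma consistent_insert:
  assumes f: "consistent b f U" and U: "finite U" "card (insert x U) \<le> K"
  obtains f' where "f' \<inter> U = f \<inter> U" "consistent b f' (insert x U)"
proof (cases "x \<in> U")
  case True
  then show thesis using that[of f] f by (simp add: insert_absorb)
next
  case False
  define C where "C = {S. S \<subseteq> {n..<n + m} \<and> card S \<le> 2 * K \<and> osupp N S \<subseteq> insert x U \<and> x \<in> osupp N S}"
  define ok where "ok g S \<longleftrightarrow> (odd (card (g \<inter> osupp N S)) \<longleftrightarrow> odd (card (S \<inter> b)))" for g S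
  have finS: "finite S" if "S \<subseteq> {n..<n + m}" for S using that finite_subset by blast
  have small: "card S \<le> K" if "S \<in> C" for S
  proof -
    have "card S \<le> card (osupp N S)" using that by (intro expand) (auto simp: C_def)
    also have "\<dots> \<le> card (insert x U)" using that U(1) by (intro card_mono) (auto simp: C_def)
    finally show ?thesis using U by simp
  qed
  have fin_supp: "finite (osupp N S)" if "S \<in> C" for S
    using that U(1) finite_subset[of "osupp N S" "insert x U"] by (simp add: C_def)
  \<comment> \<open>The constraints that mention \<open>x\<close> all hold or all fail, as the
    difference of two of them no longer mentions \<open>x\<close>.\<close>
  have agree: "ok g S \<longleftrightarrow> ok g T" if ST: "S \<in> C" "T \<in> C" and g: "g \<inter> U = f \<inter> U" for g S T
  proof -
    let ?D = "sym_diff S T"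
    have fin: "finite S" "finite T" using ST finS by (auto simp: C_def)
    have supp: "osupp N ?D = sym_diff (osupp N S) (osupp N T)" using fin by (rule osupp_sym_diff)
    have sub: "osupp N ?D \<subseteq> U" unfolding supp using ST by (auto simp: C_def)
    have "card ?D \<le> card (S \<union> T)" using fin by (intro card_mono) auto
    also have "\<dots> \<le> card S + card T" by (rule card_Un_le)
    also have "\<dots> \<le> 2 * K" using small[OF ST(1)] small[OF ST(2)] by simp
    finally have card: "card ?D \<le> 2 * K" .
    have "?D \<subseteq> {n..<n + m}" using ST by (auto simp: C_def)
    from f[unfolded consistent_def, rule_format, OF this card sub]
    have "odd (card (f \<inter> osupp N ?D)) \<longleftrightarrow> odd (card (?D \<inter> b))" .
    moreover have "f \<inter> osupp N ?D = sym_diff (g \<inter> osupp N S) (g \<inter> osupp N T)"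
    proof -
      have "f \<inter> osupp N ?D = g \<inter> osupp N ?D" using sub g by blast
      then show ?thesis unfolding supp by blast
    qed
    moreover have "?D \<inter> b = sym_diff (S \<inter> b) (T \<inter> b)" by blast
    ultimately show ?thesis
      using odd_card_sym_diff[of "g \<inter> osupp N S" "g \<inter> osupp N T"]
        odd_card_sym_diff[of "S \<inter> b" "T \<inter> b"] fin fin_supp ST
      unfolding ok_def by auto
  qed
  have ext: "consistent b g (insert x U)" if g: "g \<inter> U = f \<inter> U" "\<And>S. S \<in> C \<Longrightarrow> ok g S" for g
    unfolding consistent_def
  proof (intro allI impI)
    fix S assume S: "S \<subseteq> {n..<n + m}" "card S \<le> 2 * K" "osupp N S \<subseteq> insert x U"
    show "odd (card (g \<inter> osupp N S)) \<longleftrightarrow> odd (card (S \<inter> b))"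
    proof (cases "x \<in> osupp N S")
      case True
      then show ?thesis using g(2)[of S] S by (simp add: C_def ok_def)
    next
      case False
      then have sub: "osupp N S \<subseteq> U" using S by blast
      then have "g \<inter> osupp N S = f \<inter> osupp N S" using g(1) by blast
      then show ?thesis using f S sub by (simp add: consistent_def)
    qed
  qed
  show thesis
  proof (cases "\<exists>S\<in>C. \<not> ok f S")
    case False
    then show thesis using that[of f] ext[of f] by blast
  next
    case True
    then obtain S where S: "S \<in> C" "\<not> ok f S" by blast
    \<comment> \<open>Toggling \<open>x\<close> changes the parity of every sum in \<open>C\<close>,
      so it repairs all failing constraints together.\<close>
    let ?f = "sym_diff f {x}"
    have eq: "?f \<inter> U = f \<inter> U" using \<open>x \<notin> U\<close> by blast
    have "?f \<inter> osupp N S = sym_diff (f \<inter> osupp N S) {x}" using S by (auto simp: C_def)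
    then have "ok ?f S" using odd_card_sym_diff[of "f \<inter> osupp N S" "{x}"] S fin_supp
      by (auto simp: ok_def)
    then have "ok ?f T" if "T \<in> C" for T using agree[OF S(1) that eq] by simp
    then show thesis using that[of ?f] ext[of ?f] eq by blast
  qed
qed

lemma consistent_extend:
  assumes "finite T" "finite U" "consistent b f U" "card (U \<union> T) \<le> K"
  shows "\<exists>f'. f' \<inter> U = f \<inter> U \<and> consistent b f' (U \<union> T)"
  using assms
proof (induction T rule: finite_induct)
  case (insert x T)
  have "card (U \<union> T) \<le> card (U \<union> insert x T)" using insert by (intro card_mono) auto
  then obtain f' where f': "f' \<inter> U = f \<inter> U" "consistent b f' (U \<union> T)"
    using insert.IH insert.prems by auto
  obtain f'' where "f'' \<inter> (U \<union> T) = f' \<inter> (U \<union> T)" "consistent b f'' (insert x (U \<union> T))"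
    by (rule consistent_insert[OF f'(2), of x]) (use insert in auto)
  then show ?case using f'(1) by (intro exI[of _ f'']) auto
qed auto

text \<open>The colouring shows, up to the right-hand side \<^term>\<open>b\<close>, whether an assignment satisfies its equation;
  only for equation \<^term>\<open>j0\<close> this is hidden.\<close>
definition parity_col :: "nat \<Rightarrow> nat set \<Rightarrow> nat \<Rightarrow> nat" where
  "parity_col j0 b v = prod_encode (lab v, if lab v \<in> {n..<n + m} - {j0}
     then (card (sub v) + (if lab v \<in> b then 1 else 0)) mod 2 else 0)"

text \<open>Consistency for the single equation \<open>lab v\<close> makes the flip shift its parity
  by its right-hand side, which is exactly the difference between the two colourings.\<close>

lemma parity_col_flip:
  assumes f: "consistent b f U" and v: "v \<in> V" "N (lab v) \<subseteq> U" and K: "0 < K"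
  shows "parity_col j0 {} v = parity_col j0 b (flip f v)"
proof (cases "lab v \<in> {n..<n + m} - {j0}")
  case True
  let ?j = "lab v"
  have "odd (card (f \<inter> osupp N {?j})) \<longleftrightarrow> odd (card ({?j} \<inter> b))"
    by (rule f[unfolded consistent_def, rule_format]) (use True v K in auto)
  then have "odd (card (f \<inter> N ?j)) \<longleftrightarrow> ?j \<in> b" by (cases "?j \<in> b") simp_all
  then have "odd (card (sub (flip f v))) \<longleftrightarrow> odd (card (sub v)) \<noteq> (?j \<in> b)"
    using odd_card_sym_diff[of "sub v" "f \<inter> N ?j"] by simp
  then have "card (sub v) mod 2 = (card (sub (flip f v)) + (if ?j \<in> b then 1 else 0)) mod 2"
    by (auto simp: mod2_eq_if)
  then show ?thesis using True by (simp add: parity_col_def del: sub_flip)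
qed (auto simp: parity_col_def)

section \<open>Duplicator's strategy\<close>

text \<open>The pebbles on one side are the flips of those on the other by a partial solution
  consistent on all pebbled variables. A pebble touches at most five variables, hence
  \<open>5 * k <= K\<close>.\<close>

lemma csat_flip_equiv:
  assumes k: "0 < k" "5 * k \<le> K" and p: "p \<in> cCk k"
    and f: "consistent b f (N (lab v))" and v: "v \<in> V"
  shows "csat H (parity_col j0 {}) (\<lambda>_. v) p \<longleftrightarrow> csat H (parity_col j0 b) (\<lambda>_. flip f v) p"
proof -
  define Us where "Us I a = (\<Union>i\<in>I. N (lab (a i)))" for I and a :: "nat \<Rightarrow> nat"
  define Z where "Z a a' \<longleftrightarrow> (\<forall>i<k. a i \<in> V) \<and>
     (\<exists>f. consistent b f (Us {..<k} a) \<and> (\<forall>i<k. a' i = flip f (a i)))" for a a'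
  have in_Us: "N (lab (a i)) \<subseteq> Us I a" if "i \<in> I" for i I a using that by (auto simp: Us_def)
  have finUs: "finite (Us I a)" if "finite I" for I a using that by (auto simp: Us_def)
  have card_Us: "card (Us {..<k} a) \<le> K" for a
  proof -
    have "card (Us {..<k} a) \<le> (\<Sum>i<k. card (N (lab (a i))))" unfolding Us_def by (rule card_UN_le) simp
    also have "\<dots> \<le> (\<Sum>i<k. 5)" by (intro sum_mono card_N_le)
    finally show ?thesis using k by simp
  qed
  show ?thesis
  proof (rule csat_bijective_game[where Z = Z and k = k])
    fix a a' x y assume Z: "Z a a'" and xy: "x < k" "y < k"
    then obtain f where f: "\<And>i. i < k \<Longrightarrow> a' i = flip f (a i)" and a: "\<And>i. i < k \<Longrightarrow> a i \<in> V"
      by (auto simp: Z_def)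
    show "a x = a y \<longleftrightarrow> a' x = a' y" using f xy by (metis flip_flip)
    show "{a x, a y} \<in> edges H \<longleftrightarrow> {a' x, a' y} \<in> edges H"
      using f a xy by (simp add: edges_H adj_flip)
  next
    fix a a' x assume Z: "Z a a'" and x: "x < k"
    then obtain f where "consistent b f (Us {..<k} a)" "a' x = flip f (a x)" "a x \<in> V"
      by (auto simp: Z_def)
    then show "parity_col j0 {} (a x) = parity_col j0 b (a' x)"
      using parity_col_flip[of b f "Us {..<k} a" "a x" j0] in_Us[of x "{..<k}" a] x k by simp
  next
    fix a a' x assume Z: "Z a a'" and x: "x < k"
    then obtain f where f: "consistent b f (Us {..<k} a)" "\<And>i. i < k \<Longrightarrow> a' i = flip f (a i)"
      and a: "\<And>i. i < k \<Longrightarrow> a i \<in> V"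
      by (auto simp: Z_def)
    \<comment> \<open>Lifting pebble \<open>x\<close> releases its variables.\<close>
    let ?U = "Us ({..<k} - {x}) a"
    have fU: "consistent b f ?U" using f(1) by (rule consistent_subset) (auto simp: Us_def)
    have Us_upd: "Us {..<k} (a(x := v)) = ?U \<union> N (lab v)" for v
    proof -
      have "Us {..<k} (a(x := v)) = Us (insert x ({..<k} - {x})) (a(x := v))"
        using x by (simp add: insert_absorb)
      also have "\<dots> = N (lab v) \<union> Us ({..<k} - {x}) (a(x := v))"
        by (simp only: Us_def UN_insert fun_upd_same)
      also have "Us ({..<k} - {x}) (a(x := v)) = ?U" unfolding Us_def by (intro SUP_cong) auto
      finally show ?thesis by blast
    qed
    \<comment> \<open>One extension is fixed for every label, so the bijection can flip each block
      separately and still agree with \<open>f\<close> on the remaining pebbles.\<close>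
    have "\<exists>g. g \<inter> ?U = f \<inter> ?U \<and> consistent b g (?U \<union> N l)" for l
    proof (rule consistent_extend[OF finite_N finUs fU])
      show "card (?U \<union> N l) \<le> K"
        using card_Us[of "a(x := mk l {})"] Us_upd[of "mk l {}"] by simp
    qed simp
    then obtain g where g: "\<And>l. g l \<inter> ?U = f \<inter> ?U" "\<And>l. consistent b (g l) (?U \<union> N l)"
      by metis
    let ?h = "\<lambda>v. flip (g (lab v)) v"
    have "bij_betw ?h V V" by (rule bij_betwI[where g = ?h]) auto
    moreover have "Z (a(x := v)) (a'(x := ?h v))" if v: "v \<in> V" for v
      unfolding Z_def Us_upd
    proof (intro conjI exI[of _ "g (lab v)"] allI impI)
      fix i assume i: "i < k"
      show "(a(x := v)) i \<in> V" using v a i by simp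
      have "flip (g (lab v)) (a i) = flip f (a i)" if "i \<noteq> x"
        using g(1)[of "lab v"] in_Us[of i "{..<k} - {x}" a] i that by (intro flip_cong) auto
      then show "(a'(x := ?h v)) i = flip (g (lab v)) ((a(x := v)) i)" using f(2) i by simp
    qed (rule g(2))
    ultimately show "\<exists>h. bij_betw h (verts H) (verts H) \<and> (\<forall>v\<in>verts H. Z (a(x := v)) (a'(x := h v)))"
      by auto
  next
    have "Us {..<k} (\<lambda>_. v) = N (lab v)" using k by (auto simp: Us_def)
    then show "Z (\<lambda>_. v) (\<lambda>_. flip f v)" using f v by (auto simp: Z_def)
  qed (use p in \<open>auto simp: cCk_def\<close>)
qed

section \<open>Isomorphisms between coloured versions\<close>

text \<open>The colour contains the label, so an isomorphism preserves blocks. Its action on the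
  variable vertices determines it on the equation vertices, which are known from their neighbours
  among the variable vertices.\<close>

lemma parity_col_iso_flip:
  assumes f: "cgraph_iso H (parity_col j0 b) H (parity_col j0 b') f"
  obtains g where "\<And>v. v \<in> V \<Longrightarrow> lab v < n + m \<Longrightarrow> f v = flip g v"
proof -
  have bij: "bij_betw f V V" and edge: "\<And>u v. u \<in> V \<Longrightarrow> v \<in> V \<Longrightarrow> adj (f u) (f v) \<longleftrightarrow> adj u v"
    using f by (auto simp: cgraph_iso_def graph_iso_def edges_H bij_betw_def)
  have fV: "f v \<in> V" if "v \<in> V" for v using bij that by (auto simp: bij_betw_def)
  have col: "parity_col j0 b' (f v) = parity_col j0 b v" if "v \<in> V" for v
    using f that by (simp add: cgraph_iso_def)
  have lab: "lab (f v) = lab v" if "v \<in> V" for v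
    using col[OF that] by (auto simp: parity_col_def)
  \<comment> \<open>The variables whose two vertices are exchanged by \<open>f\<close>.\<close>
  define g where "g = {x. x < n \<and> f (mk x {}) \<noteq> mk x {}}"
  have var_V: "mk x {} \<in> V" if "x < n" for x using that by (auto intro: mk_empty_in_V simp: leaf_def)
  have var0: "x \<in> sub (f (mk x {})) \<longleftrightarrow> x \<in> g" if "x < n" for x
  proof -
    have "sub (f (mk x {})) \<subseteq> {x}" "lab (f (mk x {})) = x"
      using fV[OF var_V[OF that]] lab[OF var_V[OF that]] that by (auto simp: V_def)
    then have "f (mk x {}) \<noteq> mk x {} \<longleftrightarrow> sub (f (mk x {})) \<noteq> {}"
      using vertex_eqI[of "f (mk x {})" "mk x {}"] by auto
    then show ?thesis using \<open>sub (f (mk x {})) \<subseteq> {x}\<close> that by (auto simp: g_def)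
  qed
  have eqn: "sub (f v) = sub (flip g v)" if v: "v \<in> V" "n \<le> lab v" "lab v < n + m" for v
  proof -
    have "x \<in> sub (f v) \<longleftrightarrow> x \<in> sub (flip g v)" if x: "x \<in> N (lab v)" for x
    proof -
      have xn: "x < n" using x N_subset by auto
      have i: "inc0 x (lab v)" using v x xn by (simp add: inc0_def)
      have "adj (mk x {}) v \<longleftrightarrow> x \<notin> sub v"
        using adj_inc[of "mk x {}" v] i v var_V[OF xn] by simp
      moreover have "adj (f (mk x {})) (f v) \<longleftrightarrow> (x \<in> g \<longleftrightarrow> x \<in> sub (f v))"
        using adj_inc[of "f (mk x {})" "f v"] i v var_V[OF xn] fV lab var0[OF xn] by simp
      ultimately show ?thesis using edge[OF var_V[OF xn] v(1)] x by auto
    qed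
    moreover have "sub (f v) \<subseteq> N (lab v)" "sub (flip g v) \<subseteq> N (lab v)"
      using fV[OF v(1)] flip_in_V[OF v(1), of g] lab[OF v(1)] by (auto simp: V_def)
    ultimately show ?thesis by blast
  qed
  have var: "sub (f v) = sub (flip g v)" if v: "v \<in> V" "lab v < n" for v
  proof -
    let ?x = "lab v"
    have sub: "sub v \<subseteq> {?x}" "sub (f v) \<subseteq> {?x}" "sub (flip g v) \<subseteq> {?x}"
      using v(1) fV[OF v(1)] flip_in_V[OF v(1), of g] lab[OF v(1)] v(2) by (auto simp: V_def)
    show ?thesis
    proof (cases "sub v = {}")
      case True
      then have "v = mk ?x {}" by (metis mk_lab_sub)
      then show ?thesis using var0[OF v(2)] sub True v(2) by (auto simp: subset_singleton_iff)
    next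
      case False
      then have "v \<noteq> mk ?x {}" by (metis finite.emptyI sub_mk)
      then have "f v \<noteq> f (mk ?x {})"
        using bij v var_V by (auto simp: bij_betw_def inj_on_def)
      then have "sub (f v) \<noteq> sub (f (mk ?x {}))"
        using vertex_eqI[of "f v" "f (mk ?x {})"] lab v var_V by auto
      moreover have "sub (f (mk ?x {})) \<subseteq> {?x}"
        using fV[OF var_V[OF v(2)]] lab[OF var_V[OF v(2)]] v(2) by (auto simp: V_def)
      ultimately show ?thesis using var0[OF v(2)] sub False v(2) by (auto simp: subset_singleton_iff)
    qed
  qed
  show thesis
  proof (rule that)
    fix v assume v: "v \<in> V" "lab v < n + m"
    show "f v = flip g v"
    proof (rule vertex_eqI)
      show "lab (f v) = lab (flip g v)" using lab[OF v(1)] by simp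
      show "sub (f v) = sub (flip g v)"
        using eqn[OF v(1)] var[OF v(1)] v(2) by (cases "lab v < n") (simp_all del: sub_flip)
    qed
  qed
qed

text \<open>The colour of the all-zero assignment of an equation reveals how \<open>g\<close> moves
  its parity: apart from equation \<open>j0\<close>, \<open>g\<close> solves the system whose
  right-hand side is the difference of \<open>b\<close> and \<open>b'\<close>.\<close>

lemma parity_col_iso_parity:
  assumes f: "cgraph_iso H (parity_col j0 b) H (parity_col j0 b') f"
  obtains g where "\<And>v. v \<in> V \<Longrightarrow> lab v < n + m \<Longrightarrow> f v = flip g v"
    "\<And>j. j \<in> {n..<n + m} - {j0} \<Longrightarrow> odd (card (g \<inter> N j)) \<longleftrightarrow> (j \<in> b) \<noteq> (j \<in> b')"
proof -
  obtain g where g: "\<And>v. v \<in> V \<Longrightarrow> lab v < n + m \<Longrightarrow> f v = flip g v"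
    using parity_col_iso_flip[OF f] by blast
  have "odd (card (g \<inter> N j)) \<longleftrightarrow> (j \<in> b) \<noteq> (j \<in> b')" if j: "j \<in> {n..<n + m} - {j0}" for j
  proof -
    have v: "mk j {} \<in> V" using j by (auto intro: mk_empty_in_V simp: leaf_def)
    then have "parity_col j0 b' (f (mk j {})) = parity_col j0 b (mk j {})"
      using f by (simp add: cgraph_iso_def)
    moreover have "f (mk j {}) = flip g (mk j {})" using g v j by simp
    ultimately have "parity_col j0 b' (flip g (mk j {})) = parity_col j0 b (mk j {})" by simp
    then have "(card (g \<inter> N j) + (if j \<in> b' then 1 else 0)) mod 2 = (if j \<in> b then 1 else 0) mod 2"
      using j by (simp add: parity_col_def)
    then show ?thesis by (auto simp: mod2_eq_if split: if_splits)
  qed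
  then show thesis using that g by blast
qed

text \<open>The left-hand sides in \<open>S\<close> cancel, so no right-hand side of odd weight on
  \<open>S\<close> has a solution.\<close>

lemma dependency_even:
  assumes "S \<subseteq> {n..<n + m}" "osupp N S = {}"
  shows "even (card {j \<in> S. odd (card (g \<inter> N j))})"
proof -
  have "finite S" using assms(1) finite_subset by blast
  then show ?thesis using odd_card_Int_osupp[of S N g] assms(2) by simp
qed

lemma ex_consistent:
  assumes "5 \<le> K"
  shows "\<exists>f. consistent b f (N l)"
proof -
  have "card ({} \<union> N l) \<le> K" using card_N_le[of l] assms by simp
  from consistent_extend[OF finite_N _ consistent_empty this] show ?thesis by auto
qed

text \<open>The right-hand side \<open>{j1}\<close> with \<open>j1\<close> in \<open>S\<close> has
  odd weight on a dependency, so its coloured graph is not isomorphic to that of \<open>{}\<close>,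
  although \<open>C^k\<close> cannot tell them apart. As \<open>S\<close> avoids \<open>j0\<close>,
  all parities involved are visible in the colours.\<close>

lemma not_cidentified_H:
  assumes k: "0 < k" "5 * k \<le> K"
    and S: "S \<subseteq> {n..<n + m} - {j0}" "S \<noteq> {}" "osupp N S = {}"
  shows "\<not> cidentified k H (parity_col j0 {})"
proof
  assume "cidentified k H (parity_col j0 {})"
  then obtain p where p: "p \<in> cCk k" "free_vars p = {}" "\<And>a. csat H (parity_col j0 {}) a p"
    and iso: "\<And>\<chi>'. (\<forall>a. csat H \<chi>' a p) \<Longrightarrow> \<exists>f. cgraph_iso H (parity_col j0 {}) H \<chi>' f"
    using is_graph_H unfolding cidentified_def by blast
  obtain j1 where j1: "j1 \<in> S" using S by blast
  \<comment> \<open>Any start vertex serves, as \<open>p\<close> is a sentence.\<close>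
  let ?v = "mk 0 {}"
  have v: "?v \<in> V" by (simp add: mk_empty_in_V)
  have "5 \<le> K" using k by simp
  then obtain f where f: "consistent {j1} f (N (lab ?v))" using ex_consistent by blast
  have "csat H (parity_col j0 {j1}) (\<lambda>_. flip f ?v) p"
    using csat_flip_equiv[OF k p(1) f v, of j0] p(3) by simp
  then have "csat H (parity_col j0 {j1}) a p" for a
    using csat_free_cong[of p a "\<lambda>_. flip f ?v"] p(2) by simp
  then obtain h where "cgraph_iso H (parity_col j0 {}) H (parity_col j0 {j1}) h" using iso by blast
  then obtain g where g: "\<And>j. j \<in> {n..<n + m} - {j0} \<Longrightarrow> odd (card (g \<inter> N j)) \<longleftrightarrow> j = j1"
    using parity_col_iso_parity[of j0 "{}" "{j1}" h] by simp metis
  have "odd (card (g \<inter> N j)) \<longleftrightarrow> j = j1" if "j \<in> S" for j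
    using g subsetD[OF S(1) that] by blast
  then have "{j \<in> S. odd (card (g \<inter> N j))} = {j1}" using j1 by auto
  then show False using dependency_even[of S g] S by auto
qed

text \<open>With \<open>j0\<close> hidden, the right-hand sides \<open>{}\<close> and
  \<open>{j0}\<close> give the same colouring, so Duplicator's strategy compares the graph with
  itself and moves an even vertex of block \<open>j0\<close> to an odd one. Automorphisms keep the
  parity of all other equations in \<open>S\<close>, hence by the dependency also that of
  \<open>j0\<close>.\<close>

lemma cCk_partition_H_ne_corbits:
  assumes k: "0 < k" "5 * k \<le> K"
    and S: "S \<subseteq> {n..<n + m}" "j0 \<in> S" "osupp N S = {}"
  shows "cCk_partition k H (parity_col j0 {}) \<noteq> corbits H (parity_col j0 {})"
proof
  let ?\<chi> = "parity_col j0 {}"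
  assume eq: "cCk_partition k H ?\<chi> = corbits H ?\<chi>"
  let ?v = "mk j0 {}"
  have j0: "n \<le> j0" "j0 < n + m" using S by auto
  have v: "?v \<in> V" using j0 by (intro mk_empty_in_V) (simp add: leaf_def)
  have K: "5 \<le> K" using k by simp
  then obtain f where f: "consistent {j0} f (N (lab ?v))" using ex_consistent by blast
  let ?w = "flip f ?v"
  have "odd (card (f \<inter> osupp N {j0})) \<longleftrightarrow> odd (card ({j0} \<inter> {j0}))"
    by (rule f[unfolded consistent_def, rule_format]) (use j0 K in auto)
  then have odd_w: "odd (card (sub ?w))" by simp
  have "parity_col j0 {j0} = ?\<chi>" by (auto simp: parity_col_def)
  then have "cvtype k H ?\<chi> ?w = cvtype k H ?\<chi> ?v"
    using csat_flip_equiv[OF k _ f v, of _ j0] by (auto simp: cvtype_def)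
  then have "{u \<in> V. cvtype k H ?\<chi> u = cvtype k H ?\<chi> ?v} \<in> corbits H ?\<chi>"
    and w_in: "?w \<in> {u \<in> V. cvtype k H ?\<chi> u = cvtype k H ?\<chi> ?v}"
    using v unfolding eq[symmetric] cCk_partition_def by auto
  then obtain u where u: "u \<in> V"
    "{u \<in> V. cvtype k H ?\<chi> u = cvtype k H ?\<chi> ?v} = {h u |h. cgraph_iso H ?\<chi> H ?\<chi> h}"
    unfolding corbits_def by auto
  have parity: "odd (card (sub (h u))) \<longleftrightarrow> odd (card (sub u))"
    if h: "cgraph_iso H ?\<chi> H ?\<chi> h" and l: "lab (h u) = j0" for h
  proof -
    have "?\<chi> (h u) = ?\<chi> u" using h u(1) by (simp add: cgraph_iso_def)
    then have lu: "lab u = j0" using l by (auto simp: parity_col_def)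
    obtain g where g: "h u = flip g u"
      "\<And>j. j \<in> {n..<n + m} - {j0} \<Longrightarrow> even (card (g \<inter> N j))"
      using parity_col_iso_parity[OF h] u(1) lu j0 by (metis (full_types))
    have "j = j0" if "j \<in> S" "odd (card (g \<inter> N j))" for j using g(2)[of j] subsetD[OF S(1) that(1)] that by auto
    then have "{j \<in> S. odd (card (g \<inter> N j))} \<subseteq> {j0}" by blast
    moreover have "even (card {j \<in> S. odd (card (g \<inter> N j))})"
      using S by (intro dependency_even)
    ultimately have "{j \<in> S. odd (card (g \<inter> N j))} = {}" by (auto simp: subset_singleton_iff)
    then have "even (card (g \<inter> N j0))" using S by blast
    then show ?thesis using odd_card_sym_diff[of "sub u" "g \<inter> N j0"] g(1) lu by simp
  qed
  have "?v \<in> {u \<in> V. cvtype k H ?\<chi> u = cvtype k H ?\<chi> ?v}" using v by simp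
  then obtain h1 h2 where h: "cgraph_iso H ?\<chi> H ?\<chi> h1" "h1 u = ?v"
    "cgraph_iso H ?\<chi> H ?\<chi> h2" "h2 u = ?w"
    using w_in unfolding u(2) by auto
  then have "odd (card (sub ?v)) \<longleftrightarrow> odd (card (sub ?w))"
    using parity[OF h(1)] parity[OF h(3)] by simp
  then show False using odd_w by simp
qed

end

section \<open>Choice of the parameters\<close>

theorem theorem6p3:
  "\<exists>c::nat. \<forall>k::nat. k > 2 \<longrightarrow>
     (\<exists>H :: nat graph. is_graph H \<and> card (verts H) \<le> c * k \<and>
        identified 3 H \<and>
        Ck_partition k H = orbits H \<and>
        (\<exists>\<chi> :: nat \<Rightarrow> nat. \<not> cidentified k H \<chi> \<and> cCk_partition k H \<chi> \<noteq> corbits H \<chi>))"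
proof (intro exI[of _ "64 * 87483"] allI impI)
  fix k :: nat assume k: "2 < k"
  \<comment> \<open>Expansion is required up to \<open>2 * K = 10 * k\<close> with
    \<open>K = 5 * k\<close>, so \<open>n = 4374 * (10 * k)\<close>. The vertex bound comes from
    \<open>n + m + 1 = 87480 * k + 3\<close>.\<close>
  define n where "n = 43740 * k"
  \<comment> \<open>Already \<open>n + 1\<close> equations are dependent; one more leaves a
    dependency after \<open>j0\<close> is removed.\<close>
  define m where "m = n + 2"
  have n: "0 < n" using k by (simp add: n_def)
  obtain F :: "nat \<Rightarrow> nat set" where F: "\<And>j. j < m \<Longrightarrow> F j \<subseteq> {..<n}" "\<And>j. j < m \<Longrightarrow> F j \<noteq> {}"
    "\<And>j. j < m \<Longrightarrow> card (F j) \<le> 5"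
    "\<And>S. S \<subseteq> {..<m} \<Longrightarrow> card S \<le> 10 * k \<Longrightarrow> 3 * card S \<le> card (\<Union>j\<in>S. F j)"
    by (rule ex_expander[of m n "10 * k"]) (use k in \<open>auto simp: n_def m_def\<close>)
  interpret cfi n m "\<lambda>j. F (j - n)"
    by unfold_locales (use n F(1-3) in \<open>auto simp: m_def less_diff_conv2\<close>)
  have N_eqn: "N j = F (j - n)" if "j \<in> {n..<n + m}" for j using that by (simp add: N_def)
  interpret cfi_expander n m "\<lambda>j. F (j - n)" "5 * k"
  proof unfold_locales
    fix S assume S: "S \<subseteq> {n..<n + m}" "card S \<le> 2 * (5 * k)"
    let ?S = "(\<lambda>j. j - n) ` S"
    have mem: "n \<le> j" "j - n < m" if "j \<in> S" for j
      using subsetD[OF S(1) that] by (auto simp: less_diff_conv2)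
    have "inj_on (\<lambda>j. j - n) S" using S(1) by (auto simp: inj_on_def subset_iff eq_diff_iff)
    then have "card ?S = card S" by (rule card_image)
    moreover have "?S \<subseteq> {..<m}" using mem by auto
    moreover have "N j = F (j - n)" if "j \<in> S" for j using N_eqn subsetD[OF S(1) that] by blast
    then have "(\<Union>j\<in>S. N j) = (\<Union>i\<in>?S. F i)" by simp
    ultimately have "3 * card S \<le> card (\<Union>j\<in>S. N j)" using F(4)[of ?S] S(2) by simp
    moreover have "finite S" using S(1) finite_subset by blast
    ultimately show "card S \<le> card (osupp N S)" by (intro card_osupp_ge card_N_le) auto
  qed
  obtain S0 where S0: "S0 \<subseteq> {n..<n + m}" "S0 \<noteq> {}" "osupp N S0 = {}"
    by (rule ex_osupp_empty[of "{n..<n + m}" "{..<n}" N]) (use N_subset in \<open>auto simp: m_def\<close>)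
  then obtain j0 where j0: "j0 \<in> S0" by blast
  \<comment> \<open>This dependency avoids \<open>j0\<close> and shows non-identification;
    \<open>S0\<close>, which contains \<open>j0\<close>, serves for the orbits.\<close>
  obtain S where S: "S \<subseteq> {n..<n + m} - {j0}" "S \<noteq> {}" "osupp N S = {}"
  proof (rule ex_osupp_empty[of "{n..<n + m} - {j0}" "{..<n}" N])
    have "j0 \<in> {n..<n + m}" using S0 j0 by blast
    then show "card {..<n} < card ({n..<n + m} - {j0})" by (simp add: m_def card_Diff_singleton)
  qed (use N_subset in auto)
  have "card (verts H) \<le> 64 * 87483 * k"
    unfolding verts_H by (rule order_trans[OF card_V_le]) (use k in \<open>simp add: n_def m_def\<close>)
  moreover have "\<not> cidentified k H (parity_col j0 {})"
    by (rule not_cidentified_H[OF _ _ S]) (use k in auto)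
  moreover have "cCk_partition k H (parity_col j0 {}) \<noteq> corbits H (parity_col j0 {})"
    by (rule cCk_partition_H_ne_corbits[OF _ _ S0(1) j0 S0(3)]) (use k in auto)
  moreover have "Ck_partition k H = orbits H" by (rule Ck_partition_H) (use k in auto)
  ultimately show "\<exists>H :: nat graph. is_graph H \<and> card (verts H) \<le> 64 * 87483 * k \<and>
        identified 3 H \<and> Ck_partition k H = orbits H \<and>
        (\<exists>\<chi> :: nat \<Rightarrow> nat. \<not> cidentified k H \<chi> \<and> cCk_partition k H \<chi> \<noteq> corbits H \<chi>)"
    using is_graph_H identified_H by blast
qed

end
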